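(* Let $p\geq 5$ be a prime, $N\in\mathbb{N}$, let $\zeta_N$ be an $N$th root of unity, and let $r,s\in\mathbb{Z}$ with $p\nmid r$. Define $\xi_{r,s,N}(n)\in\mathbb{Z}[\zeta_N]$ by $$(\zeta_N-q)^sF((\zeta_N-q)^r)=\sum_{n\geq 0}\xi_{r,s,N}(n)q^n .$$ Then for all $\lambda,m\in\mathbb{N}$ and all $j\in\{1,2,\dots,p-1-\max S(p,r,s)\}$, $$\xi_{r,s,N}(p^\lambda m-j)\equiv 0 \pmod{p^\lambda}.$$ Moreover, if $N\mid rp$ and $\mathrm{digit}_1(s-r/24;p)<p-1$, then for all $\lambda,m\in\mathbb{N}$ and all $j\in\{1,2,\dots,p-1-\max S^*(p,r,s)\}$ we also have $\xi_{r,s,N}(p^\lambda m-j)\equiv 0 \pmod{p^\lambda}$.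
   Context: $(q)_n=\prod_{k=1}^n(1-q^k)$ and $F(q)=\sum_{n\geq0}(q)_n$ is the Kontsevich–Zagier series. For a root of unity $\zeta_N$ and $r\in\mathbb{Z}$, $F((\zeta_N-q)^r)$ denotes the formal power series in $q$ with coefficients in $\mathbb{Z}[\zeta_N]$ obtained by substituting $x=(\zeta_N-q)^r$ (expanded as a power series in $q$) into $\sum_{n\ge0}(x;x)_n$; this is well defined since the $q$-adic valuation of the $n$th summand tends to infinity. For $\rho\in\mathbb{Z}[\zeta_N]$, $\rho\equiv 0\pmod{p^\lambda}$ means $\rho=p^\lambda\rho'$ for some $\rho'\in\mathbb{Z}[\zeta_N]$. $S(p,r,s)=\{0\le j\le p-1:\ j-s\equiv r\cdot \tfrac{n(3n-1)}{2}\pmod p \text{ for some } n\in\mathbb{Z}\}$, and $S^*(p,r,s)=\{j\in S(p,r,s):\ 24(j-s)\not\equiv -r\pmod p\}$. Every rational number $x$ with $p$ not dividing its denominator has a unique $p$-adic expansion $x=\sum_{k\ge0}x_kp^k$ with $x_k\in\{0,\dots,p-1\}$; $\mathrm{digit}_1(x;p)=x_1$. *)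

theory Defs
  imports "HOL-Computational_Algebra.Computational_Algebra" "HOL-Number_Theory.Number_Theory"
begin

definition Zring :: "complex \<Rightarrow> complex set" where
  "Zring z = {poly (map_poly of_int f) z | f :: int poly. True}"

definition cong0_Zring :: "complex \<Rightarrow> int \<Rightarrow> nat \<Rightarrow> complex \<Rightarrow> bool" where
  "cong0_Zring z p lam rho \<longleftrightarrow> (\<exists>rho' \<in> Zring z. rho = of_int (p ^ lam) * rho')"

definition qpoch :: "complex fps \<Rightarrow> nat \<Rightarrow> complex fps" where
  "qpoch x n = (\<Prod>k = 1..n. 1 - x ^ k)"

text \<open>Kontsevich--Zagier series F(x) = sum_{n>=0} (x;x)_n, summed in the q-adic
  (formal power series) topology.\<close>
definition KZ :: "complex fps \<Rightarrow> complex fps" where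
  "KZ x = (\<Sum>n. qpoch x n)"

definition xi :: "complex \<Rightarrow> int \<Rightarrow> int \<Rightarrow> nat \<Rightarrow> complex" where
  "xi z r s n = fps_nth ((fps_const z - fps_X) powi s * KZ ((fps_const z - fps_X) powi r)) n"

definition Sset :: "int \<Rightarrow> int \<Rightarrow> int \<Rightarrow> int set" where
  "Sset p r s = {j. 0 \<le> j \<and> j \<le> p - 1 \<and>
      (\<exists>n::int. [j - s = r * (n * (3 * n - 1) div 2)] (mod p))}"

definition Sstar :: "int \<Rightarrow> int \<Rightarrow> int \<Rightarrow> int set" where
  "Sstar p r s = {j \<in> Sset p r s. \<not> [24 * (j - s) = - r] (mod p)}"

text \<open>p-adic digits of a rational number with denominator prime to p:
  x = x_0 + p * x' with x_0 in {0..p-1} and x' p-integral; x_{k+1}(x) = x_k(x').\<close>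
definition p_integral :: "int \<Rightarrow> rat \<Rightarrow> bool" where
  "p_integral p y \<longleftrightarrow> \<not> p dvd snd (quotient_of y)"

fun padic_digit :: "nat \<Rightarrow> int \<Rightarrow> rat \<Rightarrow> int" where
  "padic_digit 0 p x =
     (THE d. 0 \<le> d \<and> d < p \<and> p_integral p ((x - of_int d) / of_int p))"
| "padic_digit (Suc k) p x =
     padic_digit k p ((x - of_int (padic_digit 0 p x)) / of_int p)"

definition digit1 :: "rat \<Rightarrow> int \<Rightarrow> int" where
  "digit1 x p = padic_digit 1 p x"

end

theory Submission
  imports Defs
begin

text \<open>Write \<open>x\<close> for a formal variable. The series \<open>(1 - x) * (\<Sum>n. (x y; y)\<^sub>n x\<^sup>n)\<close> is the partial theta
  series \<open>\<Sum>m. c\<^sub>m x\<^sup>m\<close>, where \<open>c\<^sub>m = \<chi>(m) y\<^bsup>m(m+1)/6\<^esup>\<close> and \<open>m(m+1)/6\<close> is a pentagonal number whenever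
  the sign \<open>\<chi>(m)\<close> is nonzero. Modulo \<open>p\<^sup>\<lambda>\<close> and a power of \<open>q\<close>, the element \<open>y = (\<zeta> - q)\<^sup>r\<close> satisfies
  \<open>y\<^sup>n = 1\<close> for some \<open>n > 0\<close>, so both sides become rational functions of \<open>x\<close>, and clearing the
  denominator (which takes the value 1 at \<open>x = 1\<close> and can be chosen with coefficients free of \<open>q\<close>)
  exhibits \<open>F(y)\<close>, the value at \<open>x = 1\<close>, as a finite combination of the \<open>c\<^sub>m\<close> with coefficients in
  \<open>\<int>[\<zeta>]\<close>. Hence \<open>(\<zeta> - q)\<^sup>s F((\<zeta> - q)\<^sup>r)\<close> is a combination of powers \<open>(\<zeta> - q)\<^sup>K\<close> with \<open>K mod p\<close> in
  \<open>S(p, r, s)\<close>, and for these the binomial coefficient of \<open>q\<close> to the power \<open>p\<^sup>\<lambda> m - j\<close> is divisible by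
  \<open>p\<^sup>\<lambda>\<close>.

  The terms with \<open>p\<close> dividing \<open>2m + 1\<close>, which produce the residue in \<open>S\<close> but not in \<open>S\<^sup>*\<close>, form a copy
  of the partial theta series in \<open>x\<^sup>p\<close> and \<open>y\<close> to the power \<open>p\<^sup>2\<close>, up to a monomial. Their contribution is
  that monomial times \<open>p F(y)\<close>, with \<open>y\<close> replaced by its power \<open>p\<^sup>2\<close>: the factor \<open>p\<close> makes up for the one
  lost carry in the binomial coefficients.\<close>

section \<open>The partial theta identity\<close>

definition qprod :: "'a::comm_ring_1 \<Rightarrow> 'a \<Rightarrow> nat \<Rightarrow> 'a" where
  "qprod u y n = (\<Prod>k=1..n. 1 - u * y ^ k)"

definition strange_sum :: "'a::comm_ring_1 \<Rightarrow> 'a \<Rightarrow> nat \<Rightarrow> 'a" where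
  "strange_sum u y K = (\<Sum>n<K. qprod u y n * u ^ n)"

text \<open>The recursion is read off from the functional equation G(x) = 1 - x^2 y - x^3 y^2 G(x y)
  of the partial theta series.\<close>

fun pent_coeff :: "'a::comm_ring_1 \<Rightarrow> nat \<Rightarrow> 'a" where
  "pent_coeff y 0 = 1"
| "pent_coeff y (Suc 0) = 0"
| "pent_coeff y (Suc (Suc 0)) = - y"
| "pent_coeff y (Suc (Suc (Suc m))) = - (y ^ (m + 2)) * pent_coeff y m"

lemma qprod_0 [simp]: "qprod u y 0 = 1"
  by (simp add: qprod_def)

lemma qprod_Suc: "qprod u y (Suc n) = qprod u y n * (1 - u * y ^ Suc n)"
  by (simp add: qprod_def)

lemma qprod_shift: "qprod u y (Suc n) = (1 - u * y) * qprod (u * y) y n"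
  by (induction n) (simp_all add: qprod_Suc mult_ac)

lemma strange_sum_0 [simp]: "strange_sum u y 0 = 0"
  by (simp add: strange_sum_def)

lemma strange_sum_Suc: "strange_sum u y (Suc K) = strange_sum u y K + qprod u y K * u ^ K"
  by (simp add: strange_sum_def)

text \<open>This is the functional equation G(u) = 1 - u^2 y - u^3 y^2 G(u y) for G(u) = (1 - u)
  times the full sum. Three different truncation orders make it an exact finite identity, provable
  by induction in any commutative ring.\<close>

lemma strange_sum_rec:
  "strange_sum u y (Suc (Suc K)) - u * strange_sum u y (Suc K)
     = 1 - u\<^sup>2 * y - u ^ 3 * y\<^sup>2 * ((1 - u * y) * strange_sum (u * y) y K)"
proof (induction K)
  case 0
  show ?case by (simp add: strange_sum_Suc qprod_Suc algebra_simps power2_eq_square)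
next
  case (Suc K)
  have *: "(1 - u * y) * strange_sum (u * y) y (Suc K)
      = (1 - u * y) * strange_sum (u * y) y K + qprod u y (Suc K) * (u * y) ^ K"
    unfolding strange_sum_Suc[of "u * y"] qprod_shift by (simp add: algebra_simps)
  have "strange_sum u y (Suc (Suc (Suc K))) - u * strange_sum u y (Suc (Suc K))
     = (strange_sum u y (Suc (Suc K)) - u * strange_sum u y (Suc K))
       + qprod u y (Suc (Suc K)) * u ^ (Suc (Suc K)) - u * (qprod u y (Suc K) * u ^ Suc K)"
    unfolding strange_sum_Suc[of u y "Suc (Suc K)"] strange_sum_Suc[of u y "Suc K"]
    by (simp add: algebra_simps)
  also have "\<dots> = (strange_sum u y (Suc (Suc K)) - u * strange_sum u y (Suc K))
       - u ^ 3 * y\<^sup>2 * (qprod u y (Suc K) * (u * y) ^ K)"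
    unfolding qprod_Suc[of u y "Suc K"]
    by (simp add: algebra_simps power_mult_distrib power2_eq_square power3_eq_cube)
  also have "\<dots> = 1 - u\<^sup>2 * y - u ^ 3 * y\<^sup>2 * ((1 - u * y) * strange_sum (u * y) y (Suc K))"
    unfolding Suc.IH * by (simp add: algebra_simps)
  finally show ?case .
qed

lemma strange_sum_rec':
  "(1 - u) * strange_sum u y (Suc K)
     = 1 - u\<^sup>2 * y - u ^ 3 * y\<^sup>2 * ((1 - u * y) * strange_sum (u * y) y K)
       - qprod u y (Suc K) * u ^ Suc K"
  using strange_sum_rec[of u y K] unfolding strange_sum_Suc[of u y "Suc K"]
  by (simp add: algebra_simps)

text \<open>Each use of the functional equation replaces u by u y, so u = y^a X is treated for all
  \<open>a\<close> at once. The boundary term of \<open>strange_sum_rec'\<close> has order above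
  \<open>K\<close> and does not reach coefficient \<open>i\<close>.\<close>

lemma strange_sum_nth_rec:
  fixes y :: "'a::comm_ring_1"
  assumes "i \<le> K"
  shows "fps_nth ((1 - fps_const (y ^ a) * fps_X)
            * strange_sum (fps_const (y ^ a) * fps_X) (fps_const y) (Suc K)) i =
     (if i = 0 then 1 else 0) - (if i = 2 then y ^ (2 * a + 1) else 0)
     - (if i < 3 then 0 else y ^ (3 * a + 2) *
         fps_nth ((1 - fps_const (y ^ Suc a) * fps_X)
            * strange_sum (fps_const (y ^ Suc a) * fps_X) (fps_const y) K) (i - 3))"
proof -
  define u where "u = fps_const (y ^ a) * fps_X"
  have un: "u ^ n = fps_const (y ^ (a * n)) * fps_X ^ n" for n
    by (simp add: u_def power_mult_distrib fps_const_power power_mult)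
  have uy: "u * fps_const y = fps_const (y ^ (Suc a)) * fps_X"
    by (simp add: u_def mult_ac flip: fps_const_mult)
  have "qprod u (fps_const y) (Suc K) * u ^ Suc K
      = fps_X ^ Suc K * (fps_const (y ^ (a * Suc K)) * qprod u (fps_const y) (Suc K))"
    unfolding un by (simp only: mult_ac)
  then have 1: "fps_nth (qprod u (fps_const y) (Suc K) * u ^ Suc K) i = 0"
    using assms by (simp only: fps_X_power_mult_nth) simp
  have 2: "u\<^sup>2 * fps_const y = fps_const (y ^ (2 * a + 1)) * fps_X ^ 2"
    unfolding un by (simp add: mult_ac flip: fps_const_mult)
  have 3: "u ^ 3 * (fps_const y)\<^sup>2 * f = fps_const (y ^ (3 * a + 2)) * (fps_X ^ 3 * f)" for f
  proof -
    have "fps_const (y ^ (3 * a + 2)) = fps_const (y ^ (a * 3)) * (fps_const y)\<^sup>2"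
      by (simp add: power_add fps_const_power mult_ac power2_eq_square)
    then show ?thesis
      unfolding un by (simp only: mult_ac)
  qed
  show ?thesis
    unfolding u_def [symmetric] strange_sum_rec' 2 3 uy fps_sub_nth 1
    by (simp add: fps_X_power_mult_nth fps_X_power_nth)
qed

lemma strange_sum_nth_aux:
  fixes y :: "'a::comm_ring_1"
  assumes "m < K"
  shows "fps_nth ((1 - fps_const (y ^ a) * fps_X)
            * strange_sum (fps_const (y ^ a) * fps_X) (fps_const y) K) m
         = y ^ (a * m) * pent_coeff y m"
  using assms
proof (induction y m arbitrary: a K rule: pent_coeff.induct)
  case (4 y m)
  obtain L where K: "K = Suc L" and L: "Suc (Suc (Suc m)) \<le> L"
    using "4.prems" by (cases K) auto
  have "fps_nth ((1 - fps_const (y ^ Suc a) * fps_X)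
          * strange_sum (fps_const (y ^ Suc a) * fps_X) (fps_const y) L) m
        = y ^ (Suc a * m) * pent_coeff y m"
    using L by (intro "4.IH") simp
  then show ?case
    unfolding K strange_sum_nth_rec[OF L]
    by (simp add: algebra_simps power_add power_mult eval_nat_numeral)
next
  case (1 y)
  then obtain L where K: "K = Suc L" by (cases K) auto
  show ?case unfolding K strange_sum_nth_rec[OF le0] by simp
next
  case (2 y)
  then obtain L where K: "K = Suc L" and L: "Suc 0 \<le> L" by (cases K) auto
  show ?case unfolding K strange_sum_nth_rec[OF L] by simp
next
  case (3 y)
  then obtain L where K: "K = Suc L" and L: "Suc (Suc 0) \<le> L" by (cases K) auto
  show ?case unfolding K strange_sum_nth_rec[OF L] by (simp add: mult_ac mult_2_right)
qed

lemma strange_sum_nth: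
  "m < K \<Longrightarrow> fps_nth ((1 - fps_X) * strange_sum fps_X (fps_const y) K) m = pent_coeff y m"
  using strange_sum_nth_aux[of m K y 0] by simp

section \<open>Congruences and regularised values\<close>

text \<open>Ideals are kept as sets and congruence as a relation, so that polynomials and power
  series over one fixed type serve throughout.\<close>

locale ring_ideal =
  fixes I :: "'a::comm_ring_1 set"
  assumes zero_mem: "0 \<in> I"
    and add_mem: "a \<in> I \<Longrightarrow> b \<in> I \<Longrightarrow> a + b \<in> I"
    and mult_mem: "a \<in> I \<Longrightarrow> c * a \<in> I"
begin

definition eqv :: "'a \<Rightarrow> 'a \<Rightarrow> bool"  (infix "\<simeq>" 50) where
  "a \<simeq> b \<longleftrightarrow> a - b \<in> I"

lemma sum_mem: "(\<And>x. x \<in> A \<Longrightarrow> f x \<in> I) \<Longrightarrow> sum f A \<in> I"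
  by (induction A rule: infinite_finite_induct) (auto intro: zero_mem add_mem)

lemma eqv_refl [simp, intro]: "a \<simeq> a"
  by (simp add: eqv_def zero_mem)

lemma eqv_sym: "a \<simeq> b \<Longrightarrow> b \<simeq> a"
  using mult_mem[of "a - b" "-1"] by (simp add: eqv_def)

lemma eqv_trans [trans]: "a \<simeq> b \<Longrightarrow> b \<simeq> c \<Longrightarrow> a \<simeq> c"
  using add_mem[of "a - b" "b - c"] by (simp add: eqv_def)

lemma eqv_add: "a \<simeq> b \<Longrightarrow> c \<simeq> d \<Longrightarrow> a + c \<simeq> b + d"
  using add_mem[of "a - b" "c - d"] by (simp add: eqv_def algebra_simps)

lemma eqv_mult: 
  assumes "a \<simeq> b" "c \<simeq> d" shows "a * c \<simeq> b * d"
proof -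
  have "a * c - b * d = c * (a - b) + b * (c - d)" by (simp add: algebra_simps)
  then show ?thesis using assms by (simp add: eqv_def add_mem mult_mem)
qed

lemma eqv_diff: "a \<simeq> b \<Longrightarrow> c \<simeq> d \<Longrightarrow> a - c \<simeq> b - d"
  using eqv_add[of a b "-1 * c" "-1 * d"] eqv_mult[of "-1" "-1" c d] by simp

lemma eqv_power: "a \<simeq> b \<Longrightarrow> a ^ n \<simeq> b ^ n"
  by (induction n) (auto intro: eqv_mult)

lemma eqv_sum: "(\<And>x. x \<in> A \<Longrightarrow> f x \<simeq> g x) \<Longrightarrow> sum f A \<simeq> sum g A"
  by (induction A rule: infinite_finite_induct) (auto intro: eqv_add)

lemma eqv_prod: "(\<And>x. x \<in> A \<Longrightarrow> f x \<simeq> g x) \<Longrightarrow> prod f A \<simeq> prod g A"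
  by (induction A rule: infinite_finite_induct) (auto intro: eqv_mult)

lemma qprod_eqv: "u \<simeq> u' \<Longrightarrow> y \<simeq> y' \<Longrightarrow> qprod u y n \<simeq> qprod u' y' n"
  unfolding qprod_def by (intro eqv_prod eqv_diff eqv_mult eqv_power eqv_refl)

lemma strange_sum_eqv: "u \<simeq> u' \<Longrightarrow> y \<simeq> y' \<Longrightarrow> strange_sum u y n \<simeq> strange_sum u' y' n"
  unfolding strange_sum_def by (intro eqv_sum eqv_mult qprod_eqv eqv_power)

end

section \<open>Periodicity modulo an ideal and rational generating series\<close>

lemma qprod_add: "qprod u y (n + k) = qprod u y n * qprod (u * y ^ n) y k"
  by (induction k) (simp_all add: qprod_Suc power_add mult_ac)

text \<open>Modulo the ideal the factors of \<open>qprod\<close> repeat with period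
  \<open>n\<close>, so every later term is the fixed multiple \<open>u ^ n * qprod u y n\<close> of
  the term \<open>n\<close> places earlier.\<close>

lemma (in ring_ideal) strange_sum_period:
  assumes "y ^ n \<simeq> 1"
  shows "strange_sum u y (n + K) \<simeq> strange_sum u y n + u ^ n * qprod u y n * strange_sum u y K"
proof (induction K)
  case (Suc K)
  have "qprod (u * y ^ n) y K \<simeq> qprod (u * 1) y K"
    using assms by (intro qprod_eqv eqv_mult) auto
  then have "qprod u y (n + K) * u ^ (n + K) \<simeq> (qprod u y n * qprod u y K) * u ^ (n + K)"
    unfolding qprod_add by (intro eqv_mult) auto
  from eqv_add[OF Suc.IH this]
  show ?case
    by (simp add: strange_sum_Suc algebra_simps power_add)
qed auto

definition fps_ideal :: "'a::comm_ring_1 set \<Rightarrow> 'a fps set" where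
  "fps_ideal I = {f. \<forall>n. fps_nth f n \<in> I}"

lemma (in ring_ideal) ring_ideal_fps: "ring_ideal (fps_ideal I)"
proof
  fix f g :: "'a fps" assume f: "f \<in> fps_ideal I"
  show "g * f \<in> fps_ideal I"
    using f by (auto simp: fps_ideal_def fps_mult_nth intro!: sum_mem mult_mem)
qed (auto simp: fps_ideal_def intro: zero_mem add_mem)

definition fps_ones :: "'a::comm_ring_1 fps" where
  "fps_ones = Abs_fps (\<lambda>_. 1)"

lemma fps_ones_mult: "fps_ones * (1 - fps_X) = (1 :: 'a::comm_ring_1 fps)"
proof (rule fps_ext)
  fix n show "fps_nth (fps_ones * (1 - fps_X)) n = fps_nth (1 :: 'a fps) n"
    by (cases n) (simp_all add: fps_ones_def right_diff_distrib)
qed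

lemma fps_ones_mult_nth: "fps_nth (fps_ones * f) n = (\<Sum>i\<le>n. fps_nth f i)"
  unfolding mult.commute[of fps_ones] by (simp add: fps_ones_def fps_mult_nth atLeast0AtMost)

lemma poly_1_eq_sum: "poly P (1 :: 'a::comm_ring_1) = (\<Sum>i\<le>degree P. Polynomial.coeff P i)"
  by (simp add: poly_altdef)

lemma fps_of_poly_qprod:
  "fps_of_poly (qprod [:0, 1:] [:y:] n) = qprod fps_X (fps_const y) n"
  by (simp only: qprod_def fps_of_poly_prod fps_of_poly_diff fps_of_poly_mult fps_of_poly_power
      fps_of_poly_const fps_of_poly_fps_X fps_of_poly_1)

lemma fps_of_poly_strange_sum:
  "fps_of_poly (strange_sum [:0, 1:] [:y:] n) = strange_sum fps_X (fps_const y) n"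
  by (simp only: strange_sum_def fps_of_poly_sum fps_of_poly_mult fps_of_poly_power
      fps_of_poly_qprod fps_of_poly_fps_X)

lemma poly_qprod: "poly (qprod [:0, 1:] [:y:] n) a = qprod a y n"
  by (simp add: qprod_def poly_prod)

lemma poly_strange_sum: "poly (strange_sum [:0, 1:] [:y:] n) a = strange_sum a y n"
  by (simp add: strange_sum_def poly_sum poly_qprod)

text \<open>The factor picked up over one full period at u = x; 1 minus it is the denominator of the
  generating series.\<close>

definition period_poly :: "nat \<Rightarrow> 'a::comm_ring_1 \<Rightarrow> 'a poly" where
  "period_poly n y = [:0, 1:] ^ n * qprod [:0, 1:] [:y:] n"

context ring_ideal
begin

interpretation fps: ring_ideal "fps_ideal I"
  by (rule ring_ideal_fps)

lemma fps_eqv_iff: "fps.eqv f g \<longleftrightarrow> (\<forall>n. fps_nth f n \<simeq> fps_nth g n)"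
  by (simp only: fps.eqv_def eqv_def) (simp add: fps_ideal_def)

lemma fps_eqv_const: "fps.eqv (fps_const a) (fps_const b) \<longleftrightarrow> a \<simeq> b"
  by (auto simp: fps_eqv_iff fps_const_def)

lemma eqv_nth: "fps.eqv f g \<Longrightarrow> fps_nth f n \<simeq> fps_nth g n"
  by (simp add: fps_eqv_iff)

text \<open>The series \<^term>\<open>S\<close> represents a rational function of the formal variable whose denominator
  is 1 modulo the ideal at the point 1, and whose quotient by \<open>1 - fps_X\<close> takes there the value
  \<^term>\<open>v\<close>.\<close>
definition regular_value :: "'a poly \<Rightarrow> 'a fps \<Rightarrow> 'a \<Rightarrow> bool" where
  "regular_value D S v \<longleftrightarrow> poly D 1 \<simeq> 1 \<and>
     (\<exists>P. fps.eqv (fps_of_poly D * S) ((1 - fps_X) * fps_of_poly P) \<and> poly P 1 \<simeq> v)"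

text \<open>Serves to bring two series over a common denominator before subtracting them.\<close>

lemma regular_value_mult:
  assumes "regular_value D S v" "poly D' 1 \<simeq> 1"
  shows "regular_value (D' * D) S v"
proof -
  from assms obtain P where P: "poly D 1 \<simeq> 1" "poly P 1 \<simeq> v"
    "fps.eqv (fps_of_poly D * S) ((1 - fps_X) * fps_of_poly P)"
    by (auto simp: regular_value_def)
  have "fps.eqv (fps_of_poly (D' * D) * S) ((1 - fps_X) * fps_of_poly (D' * P))"
    using fps.eqv_mult[OF fps.eqv_refl[of "fps_of_poly D'"] P(3)]
    by (simp add: fps_of_poly_mult mult_ac)
  moreover have "poly (D' * P) 1 \<simeq> v"
    using eqv_mult[OF assms(2) P(2)] by simp
  moreover have "poly (D' * D) 1 \<simeq> 1"
    using eqv_mult[OF assms(2) P(1)] by simp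
  ultimately show ?thesis by (auto simp: regular_value_def)
qed

lemma regular_value_diff:
  assumes "regular_value D S v" "regular_value D T w"
  shows "regular_value D (S - T) (v - w)"
proof -
  from assms obtain P Q where P: "poly D 1 \<simeq> 1" "poly P 1 \<simeq> v" "poly Q 1 \<simeq> w"
    "fps.eqv (fps_of_poly D * S) ((1 - fps_X) * fps_of_poly P)"
    "fps.eqv (fps_of_poly D * T) ((1 - fps_X) * fps_of_poly Q)"
    by (auto simp: regular_value_def)
  have "fps.eqv (fps_of_poly D * (S - T)) ((1 - fps_X) * fps_of_poly (P - Q))"
    using fps.eqv_diff[OF P(4,5)] by (simp add: fps_of_poly_diff algebra_simps)
  moreover have "poly (P - Q) 1 \<simeq> v - w"
    using eqv_diff[OF P(2,3)] by simp
  ultimately show ?thesis using P(1) by (auto simp: regular_value_def)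
qed

text \<open>P(1) is the coefficient of P / (1 - x) at the degree of P. As P is congruent to D S / (1
  - x), this is a coefficient of D S / (1 - x)^2, hence a finite combination of coefficients of
  S.\<close>

lemma regular_value_eqv_sum:
  assumes "regular_value D S v"
  shows "\<exists>B. v \<simeq> (\<Sum>m\<le>B. fps_nth (fps_ones * fps_ones * fps_of_poly D) (B - m) * fps_nth S m)"
proof -
  from assms obtain P where P: "poly P 1 \<simeq> v"
    "fps.eqv (fps_of_poly D * S) ((1 - fps_X) * fps_of_poly P)"
    by (auto simp: regular_value_def)
  define B where "B = degree P"
  have "fps.eqv (fps_ones * fps_ones * (fps_of_poly D * S))
          (fps_ones * fps_ones * ((1 - fps_X) * fps_of_poly P))"
    by (intro fps.eqv_mult P(2) fps.eqv_refl)
  also have "fps_ones * fps_ones * ((1 - fps_X) * fps_of_poly P)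
      = fps_ones * (fps_ones * (1 - fps_X)) * fps_of_poly P"
    by (simp only: mult_ac)
  finally have "fps_nth (fps_ones * fps_ones * (fps_of_poly D * S)) B
     \<simeq> fps_nth (fps_ones * fps_of_poly P) B"
    unfolding fps_ones_mult by (auto intro: eqv_nth)
  also have "fps_nth (fps_ones * fps_of_poly P) B = poly P 1"
    by (simp add: fps_ones_mult_nth B_def flip: poly_1_eq_sum)
  also note P(1)
  also have "fps_nth (fps_ones * fps_ones * (fps_of_poly D * S)) B
     = fps_nth (S * (fps_ones * fps_ones * fps_of_poly D)) B"
    by (simp only: mult_ac)
  also have "\<dots> = (\<Sum>m\<le>B. fps_nth (fps_ones * fps_ones * fps_of_poly D) (B - m) * fps_nth S m)"
    by (simp add: fps_mult_nth atLeast0AtMost mult.commute)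
  finally show ?thesis by (blast intro: eqv_sym)
qed

text \<open>Coefficient \<open>m\<close> of the infinite series is already that of the truncation at
  n + m + 1 terms, where \<open>strange_sum_period\<close> applies.\<close>

lemma strange_rational:
  assumes "y ^ n \<simeq> 1"
  shows "fps.eqv (fps_of_poly (1 - period_poly n y) * Abs_fps (pent_coeff y))
           ((1 - fps_X) * fps_of_poly (strange_sum [:0, 1:] [:y:] n))"
  unfolding fps_eqv_iff
proof
  fix m
  define G where "G = (\<lambda>K. (1 - fps_X) * strange_sum fps_X (fps_const y) K)"
  define S where "S = Abs_fps (pent_coeff y)"
  define W where "W = fps_X ^ n * qprod fps_X (fps_const y) n"
  have W: "fps_of_poly (period_poly n y) = W"
    by (simp add: period_poly_def W_def fps_of_poly_mult fps_of_poly_power fps_of_poly_qprod)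
  have GS: "fps_nth (G K) i = fps_nth S i" if "i < K" for i K
    using that by (simp add: G_def S_def strange_sum_nth)
  have "fps.eqv (fps_const y ^ n) 1"
    using assms fps_eqv_const[of "y ^ n" 1] by (simp add: fps_const_power)
  then have "fps.eqv (strange_sum fps_X (fps_const y) (n + Suc m))
      (strange_sum fps_X (fps_const y) n + W * strange_sum fps_X (fps_const y) (Suc m))"
    unfolding W_def by (rule fps.strange_sum_period)
  from fps.eqv_mult[OF fps.eqv_refl[of "1 - fps_X"] this]
  have *: "fps.eqv (G (n + Suc m)) (G n + W * G (Suc m))"
    by (simp add: G_def algebra_simps)
  have "fps_nth (W * G (Suc m)) m = fps_nth (W * S) m"
    by (auto simp: fps_mult_nth GS intro!: sum.cong)
  with eqv_nth[OF *, of m] have "fps_nth S m \<simeq> fps_nth (G n) m + fps_nth (W * S) m"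
    by (simp add: GS)
  from eqv_diff[OF this eqv_refl[of "fps_nth (W * S) m"]]
  have "fps_nth ((1 - W) * S) m \<simeq> fps_nth (G n) m"
    by (simp add: algebra_simps)
  then show "fps_nth (fps_of_poly (1 - period_poly n y) * Abs_fps (pent_coeff y)) m
      \<simeq> fps_nth ((1 - fps_X) * fps_of_poly (strange_sum [:0, 1:] [:y:] n)) m"
    by (simp add: fps_of_poly_diff W S_def G_def fps_of_poly_strange_sum)
qed

end

lemma ring_ideal_dvd: "ring_ideal {a. d dvd (a :: 'a::comm_ring_1)}"
  by unfold_locales auto

lemma period_poly_deform:
  "[:h:] dvd period_poly n (y + h * y') - period_poly n (y :: 'a::comm_ring_1)"
proof -
  interpret dv: ring_ideal "{a. [:h:] dvd (a :: 'a poly)}" by (rule ring_ideal_dvd)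
  have "dv.eqv [:y + h * y':] [:y:]"
    by (auto simp: dv.eqv_def intro!: dvdI[of _ _ "[:y':]"])
  then have "dv.eqv (period_poly n (y + h * y')) (period_poly n y)"
    unfolding period_poly_def by (intro dv.eqv_mult dv.qprod_eqv dv.eqv_power dv.eqv_refl)
  then show ?thesis by (simp add: dv.eqv_def)
qed

context ring_ideal
begin

interpretation fps: ring_ideal "fps_ideal I"
  by (rule ring_ideal_fps)

text \<open>The last factor is 1 - y^n. Hence \<open>period_poly n y\<close> vanishes at x = 1
  modulo the ideal, and the denominator is 1 there.\<close>

lemma qprod_1_eqv_0:
  assumes "y ^ n \<simeq> 1" "n > 0"
  shows "qprod 1 y n \<simeq> 0"
proof -
  obtain k where n: "n = Suc k" using assms(2) by (cases n) auto
  have "qprod 1 y k * (1 - 1 * y ^ n) \<simeq> qprod 1 y k * (1 - 1 * 1)"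
    by (intro eqv_mult eqv_diff assms eqv_refl)
  then show ?thesis by (simp add: n qprod_Suc)
qed

lemma poly_period_poly_eqv:
  assumes "y ^ n \<simeq> 1" "n > 0"
  shows "poly (1 - period_poly n y) 1 \<simeq> 1"
  using eqv_diff[OF eqv_refl[of 1] qprod_1_eqv_0[OF assms]]
  by (simp add: period_poly_def poly_qprod)

text \<open>The denominator \<^term>\<open>1 - period_poly n (y + h * y')\<close> is replaced by one not involving the
  deformation \<^term>\<open>h * y'\<close>: as \<^term>\<open>h\<close> is nilpotent modulo the ideal, the former divides a power
  of \<^term>\<open>1 - period_poly n y\<close>.\<close>
lemma regular_value_strange:
  assumes "(y + h * y') ^ n \<simeq> 1" "y ^ n \<simeq> 1" "n > 0" "h ^ M \<in> I"
  shows "regular_value ((1 - period_poly n y) ^ M) (Abs_fps (pent_coeff (y + h * y')))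
           (strange_sum 1 (y + h * y') n)"
proof -
  define Y where "Y = y + h * y'"
  define S where "S = Abs_fps (pent_coeff Y)"
  define Q where "Q = strange_sum [:0, 1:] [:Y:] n"
  obtain U where "period_poly n Y - period_poly n y = [:h:] * U"
    using period_poly_deform[of h n y y'] by (auto simp: Y_def elim!: dvdE)
  then have U: "1 - period_poly n y - [:h:] * U = 1 - period_poly n Y"
    by (simp add: algebra_simps)
  \<comment> \<open>A - B divides A^M - B^M, with A = \<open>1 - period_poly n y\<close> and B =
    \<open>[:h:] * U\<close>; the remaining B^M carries h^M, which lies in the ideal.\<close>
  obtain V where "(1 - period_poly n y) ^ M - ([:h:] * U) ^ M = (1 - period_poly n Y) * V"
    using power_diff_sumr2[of "1 - period_poly n y" M "[:h:] * U"] unfolding U by blast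
  then have D: "(1 - period_poly n y) ^ M = V * (1 - period_poly n Y) + [:h ^ M:] * U ^ M"
    by (simp only: power_mult_distrib poly_const_pow) (simp add: algebra_simps)
  have hM: "h ^ M \<simeq> 0" using assms(4) by (simp add: eqv_def)
  have D1: "poly ((1 - period_poly n y) ^ M) 1 \<simeq> 1"
    using eqv_power[OF poly_period_poly_eqv[OF assms(2,3)], of M] by (simp add: poly_power)
  \<comment> \<open>The cofactor \<open>V\<close> also multiplies the numerator, so V(1) has to be 1
    for the value at x = 1 to stay the same.\<close>
  have "poly V 1 * 1 + 0 * poly (U ^ M) 1 \<simeq> 
        poly V 1 * poly (1 - period_poly n Y) 1 + h ^ M * poly (U ^ M) 1"
    by (intro eqv_add eqv_mult eqv_refl eqv_sym[OF hM] eqv_sym[OF poly_period_poly_eqv])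
      (use assms in \<open>auto simp: Y_def\<close>)
  also have "\<dots> = poly ((1 - period_poly n y) ^ M) 1"
    unfolding D by simp
  also note D1
  finally have V1: "poly V 1 \<simeq> 1" by simp
  have "fps.eqv (fps_const (h ^ M)) 0"
    using hM fps_eqv_const[of "h ^ M" 0] by simp
  then have "fps.eqv (fps_of_poly V * (fps_of_poly (1 - period_poly n Y) * S)
       + fps_const (h ^ M) * (fps_of_poly (U ^ M) * S))
      (fps_of_poly V * ((1 - fps_X) * fps_of_poly Q) + 0 * (fps_of_poly (U ^ M) * S))"
    unfolding S_def Q_def
    by (intro fps.eqv_add fps.eqv_mult fps.eqv_refl strange_rational) (use assms in \<open>auto simp: Y_def\<close>)
  also have "fps_of_poly V * ((1 - fps_X) * fps_of_poly Q) + 0 * (fps_of_poly (U ^ M) * S)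
      = (1 - fps_X) * fps_of_poly (V * Q)"
    by (simp add: fps_of_poly_mult)
  also have "fps_of_poly V * (fps_of_poly (1 - period_poly n Y) * S)
       + fps_const (h ^ M) * (fps_of_poly (U ^ M) * S) = fps_of_poly ((1 - period_poly n y) ^ M) * S"
    unfolding D fps_of_poly_add fps_of_poly_mult fps_of_poly_const by (simp add: algebra_simps)
  finally have *: "fps.eqv (fps_of_poly ((1 - period_poly n y) ^ M) * S)
      ((1 - fps_X) * fps_of_poly (V * Q))" .
  have "poly (V * Q) 1 \<simeq> strange_sum 1 Y n"
    using eqv_mult[OF V1 eqv_refl[of "poly Q 1"]] by (simp add: Q_def poly_strange_sum)
  with D1 * show ?thesis
    unfolding regular_value_def S_def Y_def by blast
qed

end

text \<open>Substituting x^p turns 1 - x into (1 - x)(1 + x + ... + x^(p-1)); the second factor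
  equals \<open>p\<close> at x = 1, which is the source of the factor \<open>p\<close> in the
  value.\<close>

lemma regular_value_compose:
  fixes I :: "'a::idom set"
  assumes "ring_ideal I" "ring_ideal.regular_value I D S v" "p > 0"
  shows "ring_ideal.regular_value I (pcompose D (Polynomial.monom 1 p))
           (fps_const c * fps_X ^ a * (S oo fps_X ^ p)) (of_nat p * c * v)"
proof -
  interpret ring_ideal I by fact
  interpret fps: ring_ideal "fps_ideal I" by (rule ring_ideal_fps)
  have X0: "fps_nth (fps_X ^ p :: 'a fps) 0 = 0" using \<open>p > 0\<close> by simp
  from assms(2) obtain P where P: "poly D 1 \<simeq> 1" "poly P 1 \<simeq> v"
    "fps.eqv (fps_of_poly D * S) ((1 - fps_X) * fps_of_poly P)"
    by (auto simp: regular_value_def)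
  define P' where "P' = [:c:] * Polynomial.monom 1 a * (\<Sum>i<p. Polynomial.monom 1 i)
     * pcompose P (Polynomial.monom 1 p)"
  have comp: "fps_of_poly (pcompose A (Polynomial.monom 1 p)) = fps_of_poly A oo fps_X ^ p" for A :: "'a poly"
    using \<open>p > 0\<close> by (subst fps_of_poly_pcompose) (simp_all add: fps_of_poly_monom')
  have "fps.eqv ((fps_of_poly D * S) oo fps_X ^ p) (((1 - fps_X) * fps_of_poly P) oo fps_X ^ p)"
    using P(3) by (auto simp: fps_eqv_iff fps_nth_compose_X_power)
  from fps.eqv_mult[OF fps.eqv_refl[of "fps_const c * fps_X ^ a"] this]
  have "fps.eqv (fps_of_poly (pcompose D (Polynomial.monom 1 p)) *
       (fps_const c * fps_X ^ a * (S oo fps_X ^ p)))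
      (fps_const c * fps_X ^ a * ((1 - fps_X ^ p) * (fps_of_poly P oo fps_X ^ p)))"
    by (simp add: comp fps_compose_mult_distrib[OF X0] fps_compose_sub_distrib mult_ac
        fps_X_fps_compose_startby0[OF X0])
  also have "(1 - fps_X ^ p :: 'a fps) = (1 - fps_X) * (\<Sum>i<p. fps_X ^ i)"
    by (rule one_diff_power_eq)
  also have "fps_const c * fps_X ^ a * (((1 - fps_X) * (\<Sum>i<p. fps_X ^ i)) * (fps_of_poly P oo fps_X ^ p))
     = (1 - fps_X) * fps_of_poly P'"
    by (simp add: P'_def fps_of_poly_mult comp fps_of_poly_sum fps_of_poly_monom' fps_of_poly_const
        fps_of_poly_smult mult_ac)
  finally have "fps.eqv (fps_of_poly (pcompose D (Polynomial.monom 1 p)) *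
       (fps_const c * fps_X ^ a * (S oo fps_X ^ p))) ((1 - fps_X) * fps_of_poly P')" .
  moreover have "poly P' 1 \<simeq> of_nat p * c * v"
  proof -
    have "poly P' 1 = of_nat p * c * poly P 1"
      by (simp add: P'_def poly_pcompose poly_monom poly_sum)
    then show ?thesis using eqv_mult[OF eqv_refl P(2)] by simp
  qed
  moreover have "poly (pcompose D (Polynomial.monom 1 p)) 1 \<simeq> 1"
    using P(1) by (simp add: poly_pcompose poly_monom)
  ultimately show ?thesis by (auto simp: regular_value_def)
qed

section \<open>Expansion into pentagonal powers\<close>

text \<open>The outer variable is x, the inner one q. Weights free of q pass through the extraction
  of a coefficient of q, so divisibility depends only on the powers of zeta - q.\<close>

definition const_coeffs :: "'a::comm_ring_1 fps fps \<Rightarrow> bool" where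
  "const_coeffs f \<longleftrightarrow> (\<forall>i. \<exists>c. fps_nth f i = fps_const c)"

lemma ex_fps_const_0: "\<exists>c. 0 = fps_const c"
  by (rule exI[of _ 0]) simp

lemma ex_fps_const_1: "\<exists>c. 1 = fps_const c"
  by (rule exI[of _ 1]) simp

lemma const_coeffs_1 [simp]: "const_coeffs 1"
  by (simp add: const_coeffs_def ex_fps_const_0 ex_fps_const_1)

lemma const_coeffs_X [simp]: "const_coeffs fps_X"
  by (simp add: const_coeffs_def ex_fps_const_0 ex_fps_const_1)

lemma const_coeffs_const [simp]: "const_coeffs (fps_const (fps_const c))"
  by (auto simp add: const_coeffs_def ex_fps_const_0)

lemma const_coeffs_ones [simp]: "const_coeffs fps_ones"
  by (simp add: const_coeffs_def fps_ones_def ex_fps_const_1)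

lemma const_coeffs_diff: "const_coeffs f \<Longrightarrow> const_coeffs g \<Longrightarrow> const_coeffs (f - g)"
  unfolding const_coeffs_def by (metis fps_sub_nth fps_const_sub)

lemma fps_const_sum: "(\<Sum>x\<in>A. fps_const (f x)) = fps_const (sum f A)"
  by (rule fps_ext) (simp add: fps_sum_nth)

lemma const_coeffs_mult:
  assumes "const_coeffs f" "const_coeffs g"
  shows "const_coeffs (f * g)"
proof -
  obtain a b where "\<And>i. fps_nth f i = fps_const (a i)" "\<And>i. fps_nth g i = fps_const (b i)"
    using assms unfolding const_coeffs_def by metis
  then have "fps_nth (f * g) i = fps_const (\<Sum>j=0..i. a j * b (i - j))" for i
    by (simp add: fps_mult_nth fps_const_sum)
  then show ?thesis by (auto simp: const_coeffs_def)
qed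

lemma const_coeffs_power: "const_coeffs f \<Longrightarrow> const_coeffs (f ^ n)"
  by (induction n) (auto intro: const_coeffs_mult)

lemma const_coeffs_qprod: "const_coeffs u \<Longrightarrow> const_coeffs y \<Longrightarrow> const_coeffs (qprod u y n)"
  by (induction n) (auto simp: qprod_Suc simp del: power_Suc
      intro!: const_coeffs_mult const_coeffs_diff const_coeffs_power)

lemma const_coeffs_period_poly:
  "const_coeffs (fps_of_poly ((1 - period_poly n (fps_const c)) ^ M))"
  unfolding fps_of_poly_power fps_of_poly_diff fps_of_poly_1 period_poly_def fps_of_poly_mult
    fps_of_poly_qprod fps_of_poly_fps_X
  by (intro const_coeffs_power const_coeffs_mult const_coeffs_diff const_coeffs_qprod) auto

lemma const_coeffs_compose:
  fixes D :: "'a::idom fps poly"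
  assumes "const_coeffs (fps_of_poly D)" "p > 0"
  shows "const_coeffs (fps_of_poly (pcompose D (Polynomial.monom 1 p)))"
proof -
  have "fps_of_poly (pcompose D (Polynomial.monom 1 p)) = fps_of_poly D oo fps_X ^ p"
    using \<open>p > 0\<close> by (subst fps_of_poly_pcompose) (simp_all add: fps_of_poly_monom')
  then show ?thesis
    using assms(1) by (simp add: const_coeffs_def fps_nth_compose_X_power ex_fps_const_0)
qed

text \<open>The value of the primitive quadratic character of conductor 12 at \<open>2 * m + 1\<close>.\<close>
definition chi :: "nat \<Rightarrow> int" where
  "chi m = (if m mod 6 \<in> {0, 5} then 1 else if m mod 6 \<in> {2, 3} then -1 else 0)"

text \<open>From m to m + 3 the number m(m + 1)/6 grows by m + 2 and the character changes sign. The
  rounding in \<open>div\<close> is harmless: the division is exact wherever \<open>chi m\<close> is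
  nonzero.\<close>

lemma pent_coeff_eq: "pent_coeff y m = of_int (chi m) * y ^ (m * (m + 1) div 6)"
proof (induction y m rule: pent_coeff.induct)
  case (4 y m)
  have "Suc (Suc (Suc m)) * (Suc (Suc (Suc m)) + 1) = m * (m + 1) + (m + 2) * 6"
    by (simp add: algebra_simps)
  then have e: "Suc (Suc (Suc m)) * (Suc (Suc (Suc m)) + 1) div 6 = m * (m + 1) div 6 + (m + 2)"
    by (simp only: div_mult_self1[of 6])
  have "Suc (Suc (Suc m)) mod 6 = (m mod 6 + 3) mod 6" by presburger
  moreover have "m mod 6 \<in> {0,1,2,3,4,5}" by auto
  ultimately have c: "chi (Suc (Suc (Suc m))) = - chi m"
    by (auto simp: chi_def)
  show ?case unfolding pent_coeff.simps "4.IH" e c power_add by (simp add: mult_ac)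
qed (auto simp: chi_def)

text \<open>Here 2(a + p k) + 1 = p (2k + 1), so this is multiplicativity of the character; a mod 3
  = 1 would mean that 3 divides p.\<close>

lemma chi_mult:
  assumes "p = 2 * a + 1" "a mod 3 \<noteq> 1"
  shows "chi (a + p * k) = chi a * chi k"
proof -
  have "a mod 6 = 0 \<or> a mod 6 = 2 \<or> a mod 6 = 3 \<or> a mod 6 = 5" using assms(2) by presburger
  then have a: "a mod 6 \<in> {0, 2, 3, 5}" by simp
  have k: "k mod 6 \<in> {0,1,2,3,4,5}" by auto
  have "[a + p * k = a mod 6 + (2 * (a mod 6) + 1) * (k mod 6)] (mod 6)"
    unfolding assms(1) by (intro cong_add cong_mult cong_refl cong_mod_rightI)
  then have "chi (a + p * k) = chi (a mod 6 + (2 * (a mod 6) + 1) * (k mod 6))"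
    unfolding cong_def chi_def by (rule arg_cong)
  also have "\<dots> = chi (a mod 6) * chi (k mod 6)"
    using a k by (elim insertE emptyE; simp only:) (simp_all add: chi_def)
  also have "\<dots> = chi a * chi k" by (simp add: chi_def)
  finally show ?thesis .
qed

lemma chi_neq_0: "chi m \<noteq> 0 \<Longrightarrow> 6 dvd m * (m + 1)"
proof -
  assume "chi m \<noteq> 0"
  then have "m mod 6 \<in> {0, 2, 3, 5}" by (auto simp: chi_def split: if_splits)
  then have "(m mod 6) * ((m mod 6) + 1) mod 6 = 0" by auto
  moreover have "[m * (m + 1) = (m mod 6) * ((m mod 6) + 1)] (mod 6)"
    by (intro cong_add cong_mult cong_refl cong_mod_rightI)
  ultimately show ?thesis unfolding cong_def dvd_eq_mod_eq_0 by argo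
qed

lemma pent_coeff_dilate:
  assumes p: "p = 2 * a + 1" "a mod 3 \<noteq> 1"
  shows "pent_coeff y (a + p * k) = pent_coeff y a * pent_coeff (y ^ p\<^sup>2) k"
proof (cases "chi k = 0")
  case True
  then show ?thesis by (simp add: pent_coeff_eq chi_mult[OF p])
next
  case False
  have "chi a \<noteq> 0" using p(2) by (auto simp: chi_def) presburger+
  then obtain A B where AB: "a * (a + 1) = 6 * A" "k * (k + 1) = 6 * B"
    using chi_neq_0[of a] chi_neq_0[OF False] by (auto elim!: dvdE)
  have "(a + p * k) * (a + p * k + 1) = a * (a + 1) + p\<^sup>2 * (k * (k + 1))"
    unfolding p(1) by (simp add: algebra_simps power2_eq_square)
  also have "\<dots> = 6 * (A + p\<^sup>2 * B)" unfolding AB by (simp add: algebra_simps)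
  finally have e: "(a + p * k) * (a + p * k + 1) div 6 = A + p\<^sup>2 * B" by simp
  show ?thesis
    unfolding pent_coeff_eq e AB chi_mult[OF p]
    by (simp add: power_add mult_ac flip: power_mult)
qed

text \<open>As 2m + 1 = 2(m - a) + p, the indices a + p k are exactly the m with p dividing 2m +
  1.\<close>

lemma dilated_series_nth:
  assumes p: "p = 2 * a + 1" "a mod 3 \<noteq> 1"
  shows "fps_nth (fps_const (pent_coeff y a) * fps_X ^ a * (Abs_fps (pent_coeff (y ^ p\<^sup>2)) oo fps_X ^ p)) m
    = (if p dvd 2 * m + 1 then pent_coeff y m else 0)"
proof -
  have p0: "p > 0" using p(1) by simp
  have iff: "p dvd 2 * m + 1 \<longleftrightarrow> a \<le> m \<and> p dvd m - a"
  proof (cases "a \<le> m")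
    case True
    then have "2 * m + 1 = 2 * (m - a) + p" using p by simp
    then have "p dvd 2 * m + 1 \<longleftrightarrow> p dvd 2 * (m - a)" by simp
    also have "\<dots> \<longleftrightarrow> p dvd m - a"
      using p(1) by (intro coprime_dvd_mult_right_iff) simp
    finally show ?thesis using True by simp
  next
    case False
    then show ?thesis using p(1) by (auto dest: dvd_imp_le)
  qed
  show ?thesis
  proof (cases "p dvd 2 * m + 1")
    case True
    then have "p dvd m - a" "a \<le> m" using iff by auto
    then obtain k where "m - a = p * k" "a \<le> m" by (auto elim: dvdE)
    then have "m = a + p * k" by simp
    then show ?thesis
      using True p0 by (simp add: mult.assoc fps_X_power_mult_nth fps_nth_compose_X_power pent_coeff_dilate[OF p])
  next
    case False
    then show ?thesis
      unfolding iff by (auto simp: mult.assoc fps_X_power_mult_nth fps_nth_compose_X_power)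
  qed
qed

text \<open>The denominator is built from the constant term of \<open>y\<close>, the rest being a
  deformation by a multiple of q, so the weights \<open>e m\<close> are free of q. For the second
  claim the dilated series is subtracted first, which removes every index with p dividing 2m +
  1.\<close>

lemma strange_sum_expansion:
  fixes y :: "'b::idom fps"
  assumes "ring_ideal I"
  defines "R \<equiv> ring_ideal.eqv I"
  assumes y: "R (y ^ n) 1" "R (fps_const (fps_nth y 0) ^ n) 1" "n > 0" "fps_X ^ M \<in> I"
  shows "\<exists>B e. R (strange_sum 1 y n) (\<Sum>m\<le>B. fps_const (e m) * pent_coeff y m)" (is ?A)
    and "p = 2 * a + 1 \<Longrightarrow> a mod 3 \<noteq> 1 \<Longrightarrow>
      \<exists>B e. R (strange_sum 1 y n - of_nat p * pent_coeff y a * strange_sum 1 (y ^ p\<^sup>2) n)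
         (\<Sum>m\<le>B. fps_const (e m) * (if p dvd 2 * m + 1 then 0 else pent_coeff y m))" (is "_ \<Longrightarrow> _ \<Longrightarrow> ?B")
proof -
  interpret ring_ideal I by fact
  have *: "regular_value ((1 - period_poly n (fps_const (fps_nth f 0))) ^ M) (Abs_fps (pent_coeff f))
           (strange_sum 1 f n)" if "f ^ n \<simeq> 1" "fps_const (fps_nth f 0) ^ n \<simeq> 1" for f
  proof -
    have f: "f = fps_const (fps_nth f 0) + fps_X * fps_shift 1 f"
      by (rule fps_ext) (simp add: fps_X_mult_nth)
    show ?thesis
      using regular_value_strange[of "fps_const (fps_nth f 0)" fps_X "fps_shift 1 f" n M,
          folded f, OF that y(3,4)] .
  qed
  have ex: "\<exists>B e. v \<simeq> (\<Sum>m\<le>B. fps_const (e m) * fps_nth S m)"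
    if "regular_value D S v" "const_coeffs (fps_of_poly D)" for D S v
  proof -
    from regular_value_eqv_sum[OF that(1)] obtain B where
      B: "v \<simeq> (\<Sum>m\<le>B. fps_nth (fps_ones * fps_ones * fps_of_poly D) (B - m) * fps_nth S m)" by blast
    have "const_coeffs (fps_ones * fps_ones * fps_of_poly D)"
      by (intro const_coeffs_mult that const_coeffs_ones)
    then obtain c where c: "\<And>i. fps_nth (fps_ones * fps_ones * fps_of_poly D) i = fps_const (c i)"
      unfolding const_coeffs_def by metis
    show ?thesis by (intro exI[of _ B] exI[of _ "\<lambda>m. c (B - m)"]) (use B c in simp)
  qed
  define D1 where "D1 = (1 - period_poly n (fps_const (fps_nth y 0))) ^ M"
  have r1: "regular_value D1 (Abs_fps (pent_coeff y)) (strange_sum 1 y n)"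
    unfolding D1_def by (rule *) (use y in \<open>auto simp: R_def\<close>)
  have c1: "const_coeffs (fps_of_poly D1)"
    unfolding D1_def by (rule const_coeffs_period_poly)
  show ?A using ex[OF r1 c1] by (simp add: R_def)
  show ?B if p: "p = 2 * a + 1" "a mod 3 \<noteq> 1"
  proof -
    define D2 where "D2 = pcompose ((1 - period_poly n (fps_const (fps_nth (y ^ p\<^sup>2) 0))) ^ M) (Polynomial.monom 1 p)"
    define T where "T = fps_const (pent_coeff y a) * fps_X ^ a * (Abs_fps (pent_coeff (y ^ p\<^sup>2)) oo fps_X ^ p)"
    have p0: "p > 0" using p by simp
    have "(y ^ p\<^sup>2) ^ n \<simeq> 1" 
      using eqv_power[of "y ^ n" 1 "p\<^sup>2"] y(1) by (simp add: R_def mult.commute flip: power_mult)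
    moreover have "fps_const (fps_nth (y ^ p\<^sup>2) 0) ^ n \<simeq> 1"
      using eqv_power[of "fps_const (fps_nth y 0) ^ n" 1 "p\<^sup>2"] y(2)
      by (simp add: R_def mult.commute fps_power_zeroth flip: power_mult)
    ultimately have r2: "regular_value D2 T (of_nat p * pent_coeff y a * strange_sum 1 (y ^ p\<^sup>2) n)"
      unfolding D2_def T_def by (intro regular_value_compose assms(1) * p0)
    have c2: "const_coeffs (fps_of_poly D2)"
      unfolding D2_def by (intro const_coeffs_compose const_coeffs_period_poly p0)
    have one: "poly D1 1 \<simeq> 1" "poly D2 1 \<simeq> 1" using r1 r2 by (auto simp: regular_value_def)
    have "regular_value (D2 * D1) (Abs_fps (pent_coeff y) - T)
        (strange_sum 1 y n - of_nat p * pent_coeff y a * strange_sum 1 (y ^ p\<^sup>2) n)"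
      using regular_value_mult[OF r1 one(2)] regular_value_mult[OF r2 one(1)]
      by (auto intro!: regular_value_diff simp: mult.commute[of D1])
    from ex[OF this] have "\<exists>B e. strange_sum 1 y n - of_nat p * pent_coeff y a * strange_sum 1 (y ^ p\<^sup>2) n
        \<simeq> (\<Sum>m\<le>B. fps_const (e m) * fps_nth (Abs_fps (pent_coeff y) - T) m)"
      using c1 c2 by (auto simp: fps_of_poly_mult intro: const_coeffs_mult)
    moreover have "fps_nth (Abs_fps (pent_coeff y) - T) m = (if p dvd 2 * m + 1 then 0 else pent_coeff y m)" for m
      unfolding T_def fps_sub_nth dilated_series_nth[OF p] by auto
    ultimately show ?thesis by (simp add: R_def)
  qed
qed

section \<open>Binomial coefficients and digits\<close>

text \<open>Moves divisibility by n + j, a factor on the right, to \<open>K choose n\<close> once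
  the product of the K + i can be cancelled.\<close>

lemma binomial_shift:
  "(K choose n) * (\<Prod>i=1..j. K + i) = ((K + j) choose (n + j)) * (\<Prod>i=1..j. n + i)"
proof (induction j)
  case (Suc j)
  have "(K choose n) * (\<Prod>i=1..Suc j. K + i) = (K choose n) * (\<Prod>i=1..j. K + i) * Suc (K + j)"
    by (simp add: algebra_simps)
  also have "\<dots> = (Suc (K + j) * ((K + j) choose (n + j))) * (\<Prod>i=1..j. n + i)"
    unfolding Suc.IH by (simp only: mult_ac)
  also have "\<dots> = ((K + Suc j) choose (n + Suc j)) * (\<Prod>i=1..Suc j. n + i)"
    unfolding Suc_times_binomial_eq by (simp add: algebra_simps)
  finally show ?case .
qed simp

text \<open>The bound on K mod p says that none of K + 1, ..., K + j is a multiple of p, so their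
  product is prime to p.\<close>

lemma prime_power_dvd_binomial:
  fixes p :: nat
  assumes "prime p" "n + j = p ^ l * m" "1 \<le> j" "K mod p + j < p"
  shows "p ^ l dvd (K choose n)"
proof -
  have "p ^ l dvd n + j" using assms(2) by simp
  also have "n + j dvd (\<Prod>i=1..j. n + i)" using \<open>1 \<le> j\<close> by (intro dvd_prodI) auto
  finally have "p ^ l dvd (K choose n) * (\<Prod>i=1..j. K + i)"
    unfolding binomial_shift by simp
  moreover have "coprime (p ^ l) (\<Prod>i=1..j. K + i)"
  proof (intro coprime_power_left_iff[THEN iffD2] disjI1 prod_coprime_right)
    fix i assume "i \<in> {1..j}"
    then have "(K + i) mod p = K mod p + i"
      using assms(4) by (subst mod_add_left_eq[symmetric]) simp
    then have "\<not> p dvd K + i" using \<open>i \<in> {1..j}\<close> by (simp add: dvd_eq_mod_eq_0)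
    then show "coprime p (K + i)" using \<open>prime p\<close> by (simp add: prime_imp_coprime)
  qed
  ultimately show ?thesis by (simp add: coprime_dvd_mult_left_iff)
qed

lemma dvd_imp_eq_0: "p dvd k \<Longrightarrow> k < p \<Longrightarrow> k = (0::nat)"
  by (rule ccontr) (auto dest: dvd_imp_le)

text \<open>Since j < p, at most one of K + 1, ..., K + j is a multiple of p, and the bound on K mod
  p^2 keeps it from being a multiple of p^2. Cancelling the product thus costs at most one factor
  p.\<close>

lemma prime_power_dvd_binomial_pred:
  fixes p :: nat
  assumes "prime p" "n + j = p ^ l * m" "1 \<le> j" "j < p" "K mod p\<^sup>2 + j < p\<^sup>2"
  shows "p ^ (l - 1) dvd (K choose n)"
proof -
  have p0: "p > 0" using \<open>prime p\<close> by (rule prime_gt_0_nat)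
  let ?Q = "\<lambda>A. \<Prod>i\<in>A. K + i"
  have "p ^ l dvd n + j" using assms(2) by simp
  also have "n + j dvd (\<Prod>i=1..j. n + i)" using \<open>1 \<le> j\<close> by (intro dvd_prodI) auto
  finally have *: "p ^ l dvd (K choose n) * ?Q {1..j}"
    unfolding binomial_shift by simp
  have cop: "coprime (p ^ e) (?Q A)" if "\<And>i. i \<in> A \<Longrightarrow> \<not> p dvd K + i" for A e
    using that \<open>prime p\<close>
    by (intro coprime_power_left_iff[THEN iffD2] disjI1 prod_coprime_right) (simp add: prime_imp_coprime)
  show ?thesis
  proof (cases "\<exists>i\<in>{1..j}. p dvd K + i")
    case False
    then have "p ^ l dvd (K choose n)"
      using * cop[of "{1..j}" l] by (auto simp: coprime_dvd_mult_left_iff)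
    then show ?thesis by (rule power_le_dvd) simp
  next
    case True
    then obtain i where i: "i \<in> {1..j}" "p dvd K + i" by blast
    then obtain c where c: "K + i = p * c" by (auto elim: dvdE)
    have "(K + i) mod p\<^sup>2 = K mod p\<^sup>2 + i"
      using assms(5) i by (subst mod_add_left_eq[symmetric]) simp
    then have "\<not> p\<^sup>2 dvd K + i" using i by (simp add: dvd_eq_mod_eq_0)
    then have "\<not> p dvd c" using p0 by (simp add: c power2_eq_square)
    then have c': "coprime (p ^ (l - 1)) c" using \<open>prime p\<close> by (simp add: prime_imp_coprime)
    have rest: "\<not> p dvd K + k" if "k \<in> {1..j} - {i}" for k
    proof
      assume "p dvd K + k"
      then have "p dvd k - i" "p dvd i - k"
        using dvd_diff_nat[of p "K + k" "K + i"] dvd_diff_nat[of p "K + i" "K + k"] i by auto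
      moreover have "k - i < p" "i - k < p"
        using that i \<open>j < p\<close> by auto
      ultimately have "k - i = 0" "i - k = 0"
        using dvd_imp_eq_0[of p "k - i"] dvd_imp_eq_0[of p "i - k"] by blast+
      then show False using that by simp
    qed
    show ?thesis
    proof (cases l)
      case (Suc l')
      have "?Q {1..j} = (K + i) * ?Q ({1..j} - {i})"
        using i by (subst prod.remove[of _ i]) auto
      then have "p * p ^ l' dvd p * ((K choose n) * c * ?Q ({1..j} - {i}))"
        using * unfolding c Suc by (simp add: mult_ac)
      then have "p ^ l' dvd (K choose n) * c * ?Q ({1..j} - {i})"
        using p0 by simp
      then have "p ^ l' dvd (K choose n) * c"
        using cop[of "{1..j} - {i}" l'] rest by (simp add: coprime_dvd_mult_left_iff)
      then show ?thesis using c' by (simp add: Suc coprime_dvd_mult_left_iff)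
    qed simp
  qed
qed

section \<open>Digits of p-integral rational numbers\<close>

lemma p_integral_iff:
  assumes "prime p"
  shows "p_integral p x \<longleftrightarrow> (\<exists>u v. \<not> p dvd v \<and> x = of_int u / of_int v)"
proof
  assume "p_integral p x"
  then show "\<exists>u v. \<not> p dvd v \<and> x = of_int u / of_int v"
    unfolding p_integral_def by (metis quotient_of_div surjective_pairing)
next
  assume "\<exists>u v. \<not> p dvd v \<and> x = of_int u / of_int v"
  then obtain u v where uv: "\<not> p dvd v" "x = of_int u / of_int v" by blast
  obtain m n where mn: "quotient_of x = (m, n)" by fastforce
  have n: "n > 0" "coprime m n" "x = of_int m / of_int n"
    using mn quotient_of_denom_pos quotient_of_coprime quotient_of_div by auto
  have "v \<noteq> 0" using uv by auto
  then have "(of_int (m * v) :: rat) = of_int (u * n)"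
    using n uv by (simp add: field_simps)
  then have "n dvd m * v" unfolding of_int_eq_iff by simp
  then have "n dvd v" using n(2) by (simp add: coprime_commute coprime_dvd_mult_right_iff)
  then show "p_integral p x"
    using uv(1) by (auto simp: p_integral_def mn dest: dvd_trans)
qed

text \<open>Dividing a/b - d by p leaves a p-integral number exactly when b d is congruent to a
  modulo p, and this determines d between 0 and p - 1.\<close>

lemma padic_digit_0_eq:
  assumes "prime p" "\<not> p dvd b" "0 \<le> d" "d < p" "p dvd a - b * d"
  shows "padic_digit 0 p (of_int a / of_int b) = d"
proof -
  have b0: "b \<noteq> 0" and p0: "p \<noteq> 0" using assms by auto
  have iff: "p_integral p ((of_int a / of_int b - of_int e) / of_int p) \<longleftrightarrow> p dvd a - b * e" for e
  proof
    assume "p_integral p ((of_int a / of_int b - of_int e) / of_int p)"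
    then obtain u v where uv: "\<not> p dvd v"
      "(of_int a / of_int b - of_int e) / of_int p = (of_int u / of_int v :: rat)"
      using p_integral_iff[OF assms(1)] by blast
    have "v \<noteq> 0" using uv by auto
    then have "(of_int ((a - b * e) * v) :: rat) = of_int (u * b * p)"
      using uv(2) b0 p0 by (simp add: field_simps)
    then have "p dvd (a - b * e) * v" unfolding of_int_eq_iff by simp
    then show "p dvd a - b * e" using uv(1) assms(1) by (simp add: prime_dvd_mult_iff)
  next
    assume "p dvd a - b * e"
    then obtain c where "a - b * e = p * c" by (auto elim: dvdE)
    then have "(of_int a :: rat) = of_int (b * e + p * c)"
      unfolding of_int_eq_iff by (simp add: algebra_simps)
    then have "(of_int a / of_int b - of_int e) / of_int p = (of_int c / of_int b :: rat)"
      using b0 p0 by (simp add: field_simps)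
    then show "p_integral p ((of_int a / of_int b - of_int e) / of_int p)"
      using p_integral_iff[OF assms(1)] assms(2) by blast
  qed
  show ?thesis
    unfolding padic_digit.simps iff
  proof (rule the_equality)
    fix e assume e: "0 \<le> e \<and> e < p \<and> p dvd a - b * e"
    then have "p dvd (a - b * e) - (a - b * d)"
      using dvd_diff[of p "a - b * e" "a - b * d"] assms(5) by blast
    then have "p dvd b * (d - e)" by (simp add: algebra_simps)
    then have "p dvd d - e" using assms(1,2) by (simp add: prime_dvd_mult_iff)
    then have "[d = e] (mod p)" by (simp add: cong_iff_dvd_diff)
    then show "e = d" using e assms(3,4) by (simp add: cong_def)
  qed (use assms in auto)
qed

text \<open>An integer congruent to a/b modulo p^2 shares its two lowest digits.\<close>

lemma digit1_eq:
  assumes "prime p" "\<not> p dvd b" "[b * K = a] (mod p\<^sup>2)"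
  shows "digit1 (of_int a / of_int b) p = (K div p) mod p"
proof -
  have p0: "p > 0" using assms(1) by (rule prime_gt_0_int)
  have b0: "b \<noteq> 0" using assms(2) by auto
  obtain c where c: "a = b * K + p\<^sup>2 * c"
    using assms(3) by (metis cong_iff_lin)
  define d0 d1 where "d0 = K mod p" and "d1 = K div p"
  have K: "K = p * d1 + d0" by (simp add: d0_def d1_def)
  have e: "a - b * d0 = p * (b * d1 + p * c)"
    unfolding c K by (simp add: algebra_simps power2_eq_square)
  have 0: "padic_digit 0 p (of_int a / of_int b) = d0"
    using p0 e by (intro padic_digit_0_eq assms) (auto simp: d0_def)
  have "(of_int a :: rat) = of_int (b * d0 + p * (b * d1 + p * c))"
    using e by (simp only: of_int_eq_iff)
  then have "(of_int a / of_int b - of_int d0) / of_int p = (of_int (b * d1 + p * c) / of_int b :: rat)"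
    using b0 p0 by (simp add: field_simps)
  moreover have "padic_digit 0 p (of_int (b * d1 + p * c) / of_int b) = d1 mod p"
  proof (rule padic_digit_0_eq)
    have "b * d1 + p * c - b * (d1 mod p) = p * (b * (d1 div p) + c)"
      unfolding minus_mult_div_eq_mod [symmetric] by (simp add: algebra_simps)
    then show "p dvd b * d1 + p * c - b * (d1 mod p)" by simp
  qed (use assms p0 in auto)
  ultimately show ?thesis
    by (simp only: digit1_def One_nat_def padic_digit.simps(2) 0 d1_def)
qed

section \<open>The ring of coefficients\<close>

text \<open>A formal stand-in for zeta: congruences are proved in the domain Z[z][[q]] modulo z^N -
  1 and evaluated at zeta at the end.\<close>

definition var_z :: "int poly fps" where
  "var_z = fps_const [:0, 1:]"

definition kz_ideal :: "nat \<Rightarrow> nat \<Rightarrow> nat \<Rightarrow> int poly fps set" where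
  "kz_ideal L M N = {of_nat L * a + fps_X ^ M * b + (var_z ^ N - 1) * c | a b c. True}"

lemma kz_idealI: "of_nat L * a + fps_X ^ M * b + (var_z ^ N - 1) * c \<in> kz_ideal L M N"
  by (auto simp: kz_ideal_def)

lemma ring_ideal_kz_ideal: "ring_ideal (kz_ideal L M N)"
proof
  show "0 \<in> kz_ideal L M N" using kz_idealI[of L 0 M 0 N 0] by simp
next
  fix f g assume "f \<in> kz_ideal L M N" "g \<in> kz_ideal L M N"
  then obtain a b c a' b' c' where 
    fg: "f = of_nat L * a + fps_X ^ M * b + (var_z ^ N - 1) * c"
    "g = of_nat L * a' + fps_X ^ M * b' + (var_z ^ N - 1) * c'"
    by (auto simp: kz_ideal_def)
  have "f + g = of_nat L * (a + a') + fps_X ^ M * (b + b') + (var_z ^ N - 1) * (c + c')"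
    unfolding fg by (simp add: algebra_simps)
  then show "f + g \<in> kz_ideal L M N" by (simp only: kz_idealI)
next
  fix f g assume "f \<in> kz_ideal L M N"
  then obtain a b c where f: "f = of_nat L * a + fps_X ^ M * b + (var_z ^ N - 1) * c"
    by (auto simp: kz_ideal_def)
  have "g * f = of_nat L * (g * a) + fps_X ^ M * (g * b) + (var_z ^ N - 1) * (g * c)"
    unfolding f by (simp add: algebra_simps)
  then show "g * f \<in> kz_ideal L M N" by (simp only: kz_idealI)
qed

lemma kz_ideal_dvd:
  "of_nat L dvd f \<Longrightarrow> f \<in> kz_ideal L M N"
  "fps_X ^ M dvd f \<Longrightarrow> f \<in> kz_ideal L M N"
  "var_z ^ N - 1 dvd f \<Longrightarrow> f \<in> kz_ideal L M N"
  using kz_idealI[of L _ M 0 N 0] kz_idealI[of L 0 M _ N 0] kz_idealI[of L 0 M 0 N _]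
  by (auto elim!: dvdE)

text \<open>By absorption, i (K choose i) = K (K - 1 choose i - 1); as i divides
  \<open>fact M\<close>, a factor L survives the cancellation of i.\<close>

lemma binomial_dvd_of_fact_dvd:
  assumes "L * fact M dvd K" "0 < i" "i \<le> M"
  shows "L dvd (K choose i)"
proof (cases K)
  case (Suc k)
  obtain i' where i: "i = Suc i'" using assms(2) by (cases i) auto
  have "i dvd fact M" using assms by (intro dvd_fact) auto
  then obtain q where q: "fact M = i * q" by (auto elim: dvdE)
  obtain w where w: "K = L * fact M * w" using assms(1) by (auto elim: dvdE)
  have "i * (K choose i) = K * (k choose i')"
    using Suc_times_binomial_eq[of k i'] by (simp add: i Suc mult.commute)
  also have "\<dots> = i * (L * (q * w * (k choose i')))"
    unfolding w q by (simp add: mult_ac)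
  finally have "(K choose i) = L * (q * w * (k choose i'))" using assms(2) by simp
  then show ?thesis by simp
next
  case 0
  then show ?thesis using assms by (cases i) auto
qed

lemma var_power_nth:
  "fps_nth ((var_z - fps_X) ^ K) n = of_nat (K choose n) * ((- 1) ^ n * [:0, 1:] ^ (K - n))"
proof -
  have "(var_z - fps_X) ^ K = (\<Sum>k\<le>K. of_nat (K choose k) * (- fps_X) ^ k * var_z ^ (K - k))"
    using binomial_ring[of "- fps_X" var_z K] by simp
  also have "fps_nth \<dots> n = (\<Sum>k\<le>K. if n = k then of_nat (K choose n) * ((- 1) ^ n * [:0, 1:] ^ (K - n)) else 0)"
    unfolding fps_sum_nth
  proof (rule sum.cong)
    fix k
    have c: "fps_const ((- 1) ^ k) = (- 1 :: int poly fps) ^ k"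
      unfolding fps_const_power [symmetric] by (simp flip: fps_const_neg)
    have "fps_const (of_nat (K choose k) * ((- 1) ^ k * [:0, 1:] ^ (K - k)))
        = of_nat (K choose k) * ((- 1) ^ k * var_z ^ (K - k))"
      unfolding fps_const_mult [symmetric] c fps_of_nat var_z_def fps_const_power ..
    then have "of_nat (K choose k) * (- fps_X) ^ k * var_z ^ (K - k)
       = fps_X ^ k * fps_const (of_nat (K choose k) * ((- 1) ^ k * [:0, 1:] ^ (K - k)))"
      unfolding power_minus[of fps_X] by (simp only: mult_ac)
    then show "fps_nth (of_nat (K choose k) * (- fps_X) ^ k * var_z ^ (K - k)) n
       = (if n = k then of_nat (K choose n) * ((- 1) ^ n * [:0, 1:] ^ (K - n)) else 0)"
      by (simp only: fps_X_power_mult_nth) auto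
  qed auto
  also have "\<dots> = of_nat (K choose n) * ((- 1) ^ n * [:0, 1:] ^ (K - n))"
    by (auto simp: binomial_eq_0)
  finally show ?thesis .
qed

text \<open>The expansion of 1/(z - q) as the sum of z^(-k-1) q^k, with z^(N-1) in place of the
  inverse of z.\<close>

definition var_inv :: "nat \<Rightarrow> int poly fps" where
  "var_inv N = Abs_fps (\<lambda>k. [:0, 1:] ^ ((N - 1) * (k + 1)))"

lemma var_mult_inv:
  assumes "N \<ge> 1"
  shows "(var_z - fps_X) * var_inv N - 1 = (var_z ^ N - 1) * Abs_fps (\<lambda>k. [:0, 1:] ^ ((N - 1) * k))"
proof (rule fps_ext)
  obtain N' where N: "N = Suc N'" using assms by (cases N) auto
  define w :: "int poly" where "w = [:0, 1:]"
  have z: "var_z ^ N - 1 = fps_const (w ^ N - 1)"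
    by (simp add: var_z_def w_def fps_const_power flip: fps_const_sub)
  fix k
  show "fps_nth ((var_z - fps_X) * var_inv N - 1) k
    = fps_nth ((var_z ^ N - 1) * Abs_fps (\<lambda>k. [:0, 1:] ^ ((N - 1) * k))) k"
    unfolding z fps_mult_left_const_nth var_inv_def var_z_def w_def [symmetric]
    by (cases k) (simp_all add: N left_diff_distrib right_diff_distrib power_add mult_ac)
qed

definition var_powi :: "nat \<Rightarrow> int \<Rightarrow> int poly fps" where
  "var_powi N s = (if s \<ge> 0 then (var_z - fps_X) ^ nat s else var_inv N ^ nat (- s))"

text \<open>(z - q)^N is congruent to 1 + q g. In its K-th power the binomial coefficients with 0 <
  i <= M are multiples of L, and for i > M the power q^i is a multiple of q^M.\<close>

lemma var_period:
  assumes "L * fact M dvd K"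
  shows "ring_ideal.eqv (kz_ideal L M N) ((var_z - fps_X) ^ (N * K)) 1"
proof -
  interpret ring_ideal "kz_ideal L M N" by (rule ring_ideal_kz_ideal)
  have "(var_z - fps_X) - var_z dvd (var_z - fps_X) ^ N - var_z ^ N"
    unfolding power_diff_sumr2[of "var_z - fps_X" N] by (rule dvd_triv_left)
  then have "fps_X dvd (var_z - fps_X) ^ N - var_z ^ N" by simp
  then obtain g where g: "(var_z - fps_X) ^ N = fps_X * g + var_z ^ N"
    by (auto elim!: dvdE simp: algebra_simps)
  have "eqv ((var_z - fps_X) ^ N) (fps_X * g + 1)"
    unfolding g by (auto simp: eqv_def intro: kz_ideal_dvd)
  then have "eqv ((var_z - fps_X) ^ (N * K)) ((fps_X * g + 1) ^ K)"
    unfolding power_mult by (rule eqv_power)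
  also have "(fps_X * g + 1) ^ K = (\<Sum>i\<le>K. of_nat (K choose i) * (fps_X * g) ^ i)"
    by (simp add: binomial_ring)
  also have "eqv \<dots> ((\<Sum>i\<le>K. if i = 0 then 1 else 0))"
  proof (rule eqv_sum)
    fix i
    consider "i = 0" | "0 < i" "i \<le> M" | "M < i" by linarith
    then show "eqv (of_nat (K choose i) * (fps_X * g) ^ i) ((if i = 0 then 1 else 0))"
    proof cases
      case 2
      then have "L dvd (K choose i)" using binomial_dvd_of_fact_dvd[OF assms] by blast
      then have "of_nat L dvd of_nat (K choose i) * (fps_X * g) ^ i"
        by (auto elim!: dvdE)
      then show ?thesis using 2 by (auto simp: eqv_def intro: kz_ideal_dvd)
    next
      case 3
      then have "fps_X ^ M dvd of_nat (K choose i) * (fps_X * g) ^ i"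
        unfolding power_mult_distrib by (intro dvd_mult dvd_mult2 le_imp_power_dvd) simp
      then show ?thesis using 3 by (auto simp: eqv_def intro: kz_ideal_dvd)
    qed auto
  qed
  also have "(\<Sum>i\<le>K. if i = 0 then 1 else 0 :: int poly fps) = 1"
    by simp
  finally show ?thesis .
qed

text \<open>Periodicity replaces any integer exponent by a natural one, so ordinary binomial
  coefficients suffice.\<close>

lemma var_powi_eqv:
  assumes "N \<ge> 1" "L * fact M dvd K" "int s' = s + int (N * K) * int k"
  shows "ring_ideal.eqv (kz_ideal L M N) (var_powi N s) ((var_z - fps_X) ^ s')"
proof -
  interpret ring_ideal "kz_ideal L M N" by (rule ring_ideal_kz_ideal)
  define t where "t = var_z - fps_X"
  have tK: "eqv (t ^ (N * K * k)) (1)"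
    using eqv_power[OF var_period[OF assms(2), of N], of k] by (simp add: t_def flip: power_mult)
  show ?thesis
  proof (cases "s \<ge> 0")
    case True
    then have "s' = nat s + N * K * k" using assms(3) by (simp add: nat_eq_iff flip: of_nat_eq_iff[where 'a = int])
    then have "t ^ s' = t ^ nat s * t ^ (N * K * k)" by (simp add: power_add)
    also have "eqv \<dots> (t ^ nat s * 1)" by (intro eqv_mult tK eqv_refl)
    finally show ?thesis using True by (auto simp: var_powi_def t_def intro: eqv_sym)
  next
    case False
    define u where "u = nat (- s)"
    have u: "s' + u = N * K * k" using assms(3) False by (simp add: u_def flip: of_nat_eq_iff[where 'a = int])
    have tv: "eqv (t * var_inv N) (1)"
      unfolding eqv_def t_def var_mult_inv[OF assms(1)] by (auto intro: kz_ideal_dvd)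
    have "eqv (var_inv N ^ u * 1) (var_inv N ^ u * t ^ (N * K * k))"
      by (intro eqv_mult eqv_sym[OF tK] eqv_refl)
    also have "var_inv N ^ u * t ^ (N * K * k) = t ^ s' * (t * var_inv N) ^ u"
      unfolding u[symmetric] by (simp add: power_add power_mult_distrib mult_ac)
    also have "eqv \<dots> (t ^ s' * 1 ^ u)" by (intro eqv_mult eqv_power tv eqv_refl)
    finally show ?thesis using False by (simp add: var_powi_def t_def u_def)
  qed
qed

section \<open>Specialising the formal variable to a root of unity\<close>

definition eval_z :: "complex \<Rightarrow> int poly \<Rightarrow> complex" where
  "eval_z z q = poly (map_poly of_int q) z"

lemma map_poly_of_int_add:
  "map_poly of_int (p + q) = (map_poly of_int p + map_poly of_int q :: complex poly)"
  by (rule poly_eqI) (simp add: coeff_map_poly)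

lemma map_poly_of_int_mult:
  "map_poly of_int (p * q) = (map_poly of_int p * map_poly of_int q :: complex poly)"
  by (rule poly_eqI) (simp add: coeff_map_poly coeff_mult)

lemma eval_z_add: "eval_z z (p + q) = eval_z z p + eval_z z q"
  by (simp add: eval_z_def map_poly_of_int_add)

lemma eval_z_mult: "eval_z z (p * q) = eval_z z p * eval_z z q"
  by (simp add: eval_z_def map_poly_of_int_mult)

lemma eval_z_0 [simp]: "eval_z z 0 = 0"
  and eval_z_1 [simp]: "eval_z z 1 = 1"
  and eval_z_z [simp]: "eval_z z [:0, 1:] = z"
  by (simp_all add: eval_z_def map_poly_pCons)

lemma eval_z_of_nat: "eval_z z (of_nat k) = of_nat k"
  by (induction k) (simp_all add: eval_z_add)

lemma eval_z_uminus: "eval_z z (- p) = - eval_z z p"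
  using eval_z_add[of z p "- p"] minus_unique[of "eval_z z p" "eval_z z (- p)"] by simp

lemma eval_z_diff: "eval_z z (p - q) = eval_z z p - eval_z z q"
  using eval_z_add[of z p "- q"] by (simp add: eval_z_uminus)

lemma eval_z_sum: "eval_z z (sum f A) = (\<Sum>x\<in>A. eval_z z (f x))"
  by (induction A rule: infinite_finite_induct) (simp_all add: eval_z_add)

lemma eval_z_power: "eval_z z (p ^ n) = eval_z z p ^ n"
  by (induction n) (simp_all add: eval_z_mult)

lemma eval_z_in_Zring: "eval_z z p \<in> Zring z"
  by (auto simp: eval_z_def Zring_def)

definition eval_fps :: "complex \<Rightarrow> int poly fps \<Rightarrow> complex fps" where
  "eval_fps z f = Abs_fps (\<lambda>n. eval_z z (fps_nth f n))"

lemma eval_fps_nth [simp]: "fps_nth (eval_fps z f) n = eval_z z (fps_nth f n)"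
  by (simp add: eval_fps_def)

lemma eval_fps_mult: "eval_fps z (f * g) = eval_fps z f * eval_fps z g"
  by (rule fps_ext) (simp add: fps_mult_nth eval_z_sum eval_z_mult)

lemma eval_fps_1 [simp]: "eval_fps z 1 = 1"
  by (rule fps_ext) simp

lemma eval_fps_diff: "eval_fps z (f - g) = eval_fps z f - eval_fps z g"
  by (rule fps_ext) (simp add: eval_z_diff)

lemma eval_fps_power: "eval_fps z (f ^ n) = eval_fps z f ^ n"
  by (induction n) (simp_all add: eval_fps_mult)

lemma eval_fps_sum: "eval_fps z (sum f A) = (\<Sum>x\<in>A. eval_fps z (f x))"
  by (rule fps_ext) (simp add: fps_sum_nth eval_z_sum)

lemma eval_fps_prod: "eval_fps z (prod f A) = (\<Prod>x\<in>A. eval_fps z (f x))"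
  by (induction A rule: infinite_finite_induct) (simp_all add: eval_fps_mult)

lemma eval_fps_var_z: "eval_fps z var_z = fps_const z"
  by (rule fps_ext) (simp add: var_z_def)

lemma eval_fps_var: "eval_fps z (var_z - fps_X) = fps_const z - fps_X"
  unfolding eval_fps_diff eval_fps_var_z by (simp add: fps_eq_iff)

lemma eval_fps_qprod: "eval_fps z (qprod 1 y n) = qpoch (eval_fps z y) n"
  by (simp add: qprod_def qpoch_def eval_fps_prod eval_fps_diff eval_fps_power)

text \<open>After evaluation z^N - 1 becomes 0, so \<open>var_inv N\<close> turns into a true
  inverse, and inverses are unique.\<close>

lemma eval_fps_var_powi:
  assumes "N \<ge> 1" "z ^ N = 1"
  shows "eval_fps z (var_powi N s) = (fps_const z - fps_X) powi s"
proof -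
  have "eval_fps z ((var_z - fps_X) * var_inv N - 1) = 0"
    unfolding var_mult_inv[OF assms(1)] eval_fps_mult eval_fps_diff eval_fps_power eval_fps_var_z
    using assms(2) by (simp add: fps_const_power)
  then have "(fps_const z - fps_X) * eval_fps z (var_inv N) = 1"
    by (simp add: eval_fps_diff[of z "_ * _"] eval_fps_mult eval_fps_var)
  then have "inverse (fps_const z - fps_X) = eval_fps z (var_inv N)"
    by (rule fps_inverse_unique)
  then show ?thesis
    by (simp add: var_powi_def power_int_def eval_fps_power eval_fps_var)
qed

lemma var_powi_nth_0:
  assumes "z ^ N = 1"
  shows "eval_z z (fps_nth (var_powi N s) 0) ^ N = 1"
proof -
  have "fps_nth (var_powi N s) 0 = [:0, 1:] ^ (if s \<ge> 0 then nat s else (N - 1) * nat (- s))"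
    by (auto simp: var_powi_def fps_power_zeroth var_z_def var_inv_def power_mult)
  then have "eval_z z (fps_nth (var_powi N s) 0) ^ N = (z ^ N) ^ (if s \<ge> 0 then nat s else (N - 1) * nat (- s))"
    by (simp only: eval_z_power eval_z_z mult.commute flip: power_mult)
  then show ?thesis using assms by simp
qed

section \<open>The Kontsevich-Zagier series in the q-adic topology\<close>

text \<open>Among N consecutive exponents one is a multiple of N; its factor has constant term 1 - 1
  = 0 and contributes a power of q.\<close>

lemma fps_X_power_dvd_qpoch:
  assumes "fps_nth x 0 ^ N = 1" "N \<ge> 1"
  shows "fps_X ^ M dvd qpoch x (N * M)"
proof (induction M)
  case (Suc M)
  obtain N' where N: "N = Suc N'" using assms(2) by (cases N) auto
  have "qpoch x (N * Suc M) = qpoch x (N * M) * (\<Prod>k=N*M+1..N*M+N. 1 - x ^ k)"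
    unfolding qpoch_def using prod.ub_add_nat[of 1 "N * M" "\<lambda>k. 1 - x ^ k" N] by (simp add: add.commute)
  also have "(\<Prod>k=N*M+1..N*M+N. 1 - x ^ k) = (\<Prod>k=N*M+1..N*M+N'. 1 - x ^ k) * (1 - x ^ (N * Suc M))"
    by (simp add: N add_ac)
  finally have e: "qpoch x (N * Suc M) = (\<Prod>k=N*M+1..N*M+N'. 1 - x ^ k) * ((1 - x ^ (N * Suc M)) * qpoch x (N * M))"
    by (simp only: mult_ac)
  have "fps_nth (1 - x ^ (N * Suc M)) 0 = 0"
    unfolding power_mult using assms(1) by (simp add: fps_power_zeroth)
  then have "1 - x ^ (N * Suc M) = fps_X * fps_shift 1 (1 - x ^ (N * Suc M))"
    by (intro fps_ext) (simp add: fps_X_mult_nth)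
  then have "fps_X dvd 1 - x ^ (N * Suc M)" by (rule dvdI)
  then have "fps_X ^ Suc M dvd (1 - x ^ (N * Suc M)) * qpoch x (N * M)"
    unfolding power_Suc by (intro mult_dvd_mono Suc.IH)
  then show ?case unfolding e by (rule dvd_mult)
qed simp

lemma qpoch_nth_eq_0:
  assumes "fps_nth x 0 ^ N = 1" "N \<ge> 1" "N * M \<le> k" "i < M"
  shows "fps_nth (qpoch x k) i = 0"
proof -
  have "qpoch x (N * M) dvd qpoch x k"
    unfolding qpoch_def using assms(3) by (intro prod_dvd_prod_subset) auto
  with fps_X_power_dvd_qpoch[OF assms(1,2)] have "fps_X ^ M dvd qpoch x k"
    by (rule dvd_trans)
  then obtain g where "qpoch x k = fps_X ^ M * g" by (auto elim: dvdE)
  then show ?thesis using assms(4) by (simp add: fps_X_power_mult_nth)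
qed

lemma KZ_nth:
  assumes "fps_nth x 0 ^ N = 1" "N \<ge> 1" "N * M \<le> k" "i < M"
  shows "fps_nth (KZ x) i = fps_nth (\<Sum>n<k. qpoch x n) i"
proof -
  \<comment> \<open>The candidate for the limit: coefficient i no longer changes from N(i + 1)
    summands on.\<close>
  define F where "F = Abs_fps (\<lambda>i. fps_nth (\<Sum>n<N * Suc i. qpoch x n) i)"
  have eq: "fps_nth (\<Sum>n<k. qpoch x n) i = fps_nth F i" if "N * Suc i \<le> k" for k i
  proof -
    have "(\<Sum>n<k. fps_nth (qpoch x n) i) = (\<Sum>n<N * Suc i. fps_nth (qpoch x n) i)"
      using that by (intro sum.mono_neutral_right) (auto intro!: qpoch_nth_eq_0[OF assms(1,2), of "Suc i"])
    then show ?thesis by (simp add: F_def fps_sum_nth)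
  qed
  have "qpoch x sums F"
    unfolding sums_def tendsto_fps_iff eventually_sequentially using eq by blast
  then have "KZ x = F" by (simp add: KZ_def sums_iff)
  moreover have "N * Suc i \<le> k" using assms(3,4) by (meson Suc_leI le_trans mult_le_mono2)
  ultimately show ?thesis using eq by simp
qed

lemma xi_eq:
  assumes "N \<ge> 1" "z ^ N = 1" "N * Suc n \<le> k"
  shows "xi z r s n = eval_z z (fps_nth (var_powi N s * strange_sum 1 (var_powi N r) k) n)"
proof -
  let ?x = "(fps_const z - fps_X) powi r"
  have x: "eval_fps z (var_powi N r) = ?x" by (rule eval_fps_var_powi[OF assms(1,2)])
  have x0: "fps_nth ?x 0 ^ N = 1"
    using var_powi_nth_0[OF assms(2), of r] unfolding x[symmetric] by simp
  have "eval_fps z (var_powi N s * strange_sum 1 (var_powi N r) k)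
     = (fps_const z - fps_X) powi s * (\<Sum>i<k. qpoch ?x i)"
    by (simp add: eval_fps_mult eval_fps_var_powi[OF assms(1,2)] strange_sum_def eval_fps_sum
        eval_fps_qprod)
  then have "eval_z z (fps_nth (var_powi N s * strange_sum 1 (var_powi N r) k) n)
     = fps_nth ((fps_const z - fps_X) powi s * (\<Sum>i<k. qpoch ?x i)) n"
    by (metis eval_fps_nth)
  also have "\<dots> = fps_nth ((fps_const z - fps_X) powi s * KZ ?x) n"
    unfolding fps_mult_nth
    by (intro sum.cong) (auto simp: KZ_nth[OF x0 assms(1,3)])
  finally show ?thesis by (simp add: xi_def)
qed

text \<open>Of the three generators, q^M does not reach coefficient n < M and z^N - 1 evaluates to
  0, so only a multiple of p^l is left.\<close>

lemma cong0_Zring_eqv: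
  assumes "ring_ideal.eqv (kz_ideal (p ^ l) M N) f g" "n < M" "z ^ N = 1"
    and "of_nat (p ^ l) dvd fps_nth g n"
  shows "cong0_Zring z (int p) l (eval_z z (fps_nth f n))"
proof -
  interpret ring_ideal "kz_ideal (p ^ l) M N" by (rule ring_ideal_kz_ideal)
  obtain a b c where "f - g = of_nat (p ^ l) * a + fps_X ^ M * b + (var_z ^ N - 1) * c"
    using assms(1)[unfolded eqv_def] unfolding kz_ideal_def by blast
  then have "f = g + of_nat (p ^ l) * a + fps_X ^ M * b + (var_z ^ N - 1) * c"
    by (simp add: algebra_simps)
  moreover have "fps_nth (of_nat (p ^ l) * a) n = of_nat (p ^ l) * fps_nth a n"
    by (simp only: fps_of_nat [symmetric] fps_mult_left_const_nth)
  moreover have "var_z ^ N - 1 = fps_const ([:0, 1:] ^ N - 1)"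
    by (simp add: var_z_def fps_const_power flip: fps_const_sub)
  ultimately have "fps_nth f n = fps_nth g n + of_nat (p ^ l) * fps_nth a n + ([:0, 1:] ^ N - 1) * fps_nth c n"
    using assms(2) by (simp only: fps_add_nth fps_X_power_mult_nth fps_mult_left_const_nth) simp
  moreover obtain d where "fps_nth g n = of_nat (p ^ l) * d" using assms(4) by (auto elim: dvdE)
  ultimately have "fps_nth f n = of_nat (p ^ l) * (d + fps_nth a n) + ([:0, 1:] ^ N + - 1) * fps_nth c n"
    by (simp add: algebra_simps)
  moreover have "eval_z z ([:0, 1:] ^ N + - 1) = 0"
    unfolding eval_z_add eval_z_power eval_z_uminus using assms(3) by simp
  ultimately have "eval_z z (fps_nth f n) = of_nat (p ^ l) * eval_z z (d + fps_nth a n)"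
    by (simp only: eval_z_add[of z "_ * _"] eval_z_mult eval_z_of_nat) simp
  then show ?thesis
    unfolding cong0_Zring_def using eval_z_in_Zring by (auto simp: of_nat_power)
qed

section \<open>Divisibility of the coefficients\<close>

text \<open>The case m mod 3 = 1 is excluded; m = 3k gives the pentagonal number of index -k, and m
  = 3k + 2 that of index k + 1.\<close>

lemma pent_exponent:
  assumes "chi m \<noteq> 0"
  shows "\<exists>k::int. int (m * (m + 1) div 6) = k * (3 * k - 1) div 2"
proof -
  have "m mod 6 = 0 \<or> m mod 6 = 2 \<or> m mod 6 = 3 \<or> m mod 6 = 5"
    using assms by (auto simp: chi_def split: if_splits)
  then have "m mod 3 = 0 \<or> m mod 3 = 2" by presburger
  then have "m = 3 * (m div 3) \<or> m = 3 * (m div 3) + 2" by presburger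
  then obtain k where "m = 3 * k \<or> m = 3 * k + 2" by blast
  then show ?thesis
  proof
    assume m: "m = 3 * k"
    have "int (m * (m + 1) div 6) = (3 * (int k * (3 * int k + 1))) div (3 * 2)"
      by (simp add: m zdiv_int algebra_simps)
    also have "\<dots> = (- int k) * (3 * (- int k) - 1) div 2"
      unfolding div_mult_mult1[OF zero_neq_numeral[symmetric]] by (simp add: algebra_simps)
    finally show ?thesis by blast
  next
    assume m: "m = 3 * k + 2"
    have "int (m * (m + 1) div 6) = (3 * ((int k + 1) * (3 * int k + 2))) div (3 * 2)"
      by (simp add: m zdiv_int algebra_simps)
    also have "\<dots> = (int k + 1) * (3 * (int k + 1) - 1) div 2"
      unfolding div_mult_mult1[OF zero_neq_numeral[symmetric]] by (simp add: algebra_simps)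
    finally show ?thesis by blast
  qed
qed

lemma var_pent_coeff:
  "(var_z - fps_X) ^ s * pent_coeff ((var_z - fps_X) ^ r) m
     = fps_const (of_int (chi m)) * (var_z - fps_X) ^ (s + r * (m * (m + 1) div 6))"
  by (simp add: pent_coeff_eq fps_of_int power_add power_mult mult_ac)

text \<open>Passes to natural exponents and to a finite sum whose length \<open>k\<close> is a
  period. Residues are kept modulo p^2 because the argument for \<open>Sstar\<close> needs the
  second digit.\<close>

lemma xi_reduce:
  fixes p N n l :: nat and z :: complex and s r :: int
  assumes "p > 0" "N \<ge> 1" "z ^ N = 1"
  defines "I \<equiv> kz_ideal (p ^ l) (Suc n) N"
  obtains s' r' k where
    "[int s' = s] (mod (int p)\<^sup>2)" "[int r' = r] (mod (int p)\<^sup>2)" "k > 0"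
    "ring_ideal.eqv I (((var_z - fps_X) ^ r') ^ k) 1"
    "ring_ideal.eqv I (fps_const (fps_nth ((var_z - fps_X) ^ r') 0) ^ k) 1"
    "\<And>g. ring_ideal.eqv I ((var_z - fps_X) ^ s' * strange_sum 1 ((var_z - fps_X) ^ r') k) g \<Longrightarrow>
       of_nat (p ^ l) dvd fps_nth g n \<Longrightarrow> cong0_Zring z (int p) l (xi z r s n)"
proof -
  interpret ring_ideal I unfolding I_def by (rule ring_ideal_kz_ideal)
  define t where "t = var_z - fps_X"
  \<comment> \<open>\<open>p ^ l * fact (Suc n)\<close> yields the period; the factor p^2 lets
    lifted exponents keep their residues modulo p^2.\<close>
  define K where "K = p ^ l * fact (Suc n) * p\<^sup>2"
  have K: "p ^ l * fact (Suc n) dvd K" by (simp add: K_def)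
  have Kn: "Suc n \<le> K"
  proof -
    have "Suc n \<le> fact (Suc n)" by (rule fact_ge_self)
    also have "\<dots> \<le> K" using \<open>p > 0\<close> by (intro dvd_imp_le) (auto simp: K_def)
    finally show ?thesis .
  qed
  then have NK: "N * K > 0" "N * Suc n \<le> N * K"
    using assms(2) mult_le_mono2[OF Kn, of N] by auto
  \<comment> \<open>Adding N K |x| makes the exponent nonnegative, since N K >= 1.\<close>
  define lift where "lift x = nat (x + int (N * K) * \<bar>x\<bar>)" for x
  have lift: "int (lift x) = x + int (N * K) * int (nat \<bar>x\<bar>)" for x
  proof -
    have "1 \<le> int (N * K)" using NK(1) by linarith
    from mult_right_mono[OF this abs_ge_zero[of x]]
    show ?thesis by (simp add: lift_def)
  qed
  have p2: "(int p)\<^sup>2 dvd int (N * K)" by (simp add: K_def)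
  have cong: "[int (lift x) = x] (mod (int p)\<^sup>2)" for x
    unfolding lift using p2 by (simp add: cong_iff_dvd_diff)
  have powi: "eqv (var_powi N x) (t ^ lift x)" for x
    unfolding t_def I_def by (rule var_powi_eqv[OF assms(2) K lift])
  have "eqv (t ^ (N * K)) 1"
    unfolding t_def I_def by (rule var_period[OF K])
  from eqv_power[OF this, of "lift r"] have 1: "eqv ((t ^ lift r) ^ (N * K)) 1"
    by (simp add: mult.commute flip: power_mult)
  have "eqv (var_z ^ N) 1"
    unfolding eqv_def unfolding I_def by (rule kz_ideal_dvd(3)) simp
  from eqv_power[OF this, of "K * lift r"]
  have "eqv (var_z ^ (N * K * lift r)) 1"
    by (simp add: mult_ac flip: power_mult)
  moreover have "fps_const (fps_nth (t ^ lift r) 0) ^ (N * K) = var_z ^ (N * K * lift r)"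
    by (simp add: t_def fps_power_zeroth var_z_def fps_const_power mult.commute flip: power_mult)
  ultimately have 2: "eqv (fps_const (fps_nth (t ^ lift r) 0) ^ (N * K)) 1" by simp
  have 3: "cong0_Zring z (int p) l (xi z r s n)"
    if g: "eqv (t ^ lift s * strange_sum 1 (t ^ lift r) (N * K)) g" "of_nat (p ^ l) dvd fps_nth g n" for g
  proof -
    have "eqv (var_powi N s * strange_sum 1 (var_powi N r) (N * K))
      (t ^ lift s * strange_sum 1 (t ^ lift r) (N * K))"
      by (intro eqv_mult strange_sum_eqv powi eqv_refl)
    from eqv_trans[OF this g(1)] show ?thesis
      unfolding xi_eq[OF assms(2,3) NK(2)] I_def
      by (rule cong0_Zring_eqv) (use assms(3) g(2) in auto)
  qed
  show ?thesis
    by (rule that[OF cong[of s] cong[of r] NK(1) 1[unfolded t_def] 2[unfolded t_def] 3[unfolded t_def]])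
qed

lemma cong_exponent:
  assumes "[int s' = s] (mod P)" "[int r' = r] (mod P)"
  shows "[int (s' + r' * E) = s + r * int E] (mod P)"
  using assms by (auto intro!: cong_add cong_mult)

lemma dvd_var_power_nth:
  "q dvd (K choose n) \<Longrightarrow> of_nat q dvd fps_nth ((var_z - fps_X) ^ K) n"
  by (auto simp: var_power_nth elim!: dvdE)

text \<open>After expansion only coefficients of powers (z - q)^K remain. The lifted exponents are
  known only modulo p^2, so the hypothesis covers the whole residue class of K.\<close>

lemma xi_cong_if_binomials:
  assumes "p > 0" "N \<ge> 1" "z ^ N = 1"
    and dvd: "\<And>K m. chi m \<noteq> 0 \<Longrightarrow> [int K = s + r * int (m * (m + 1) div 6)] (mod (int p)\<^sup>2) \<Longrightarrow>
      p ^ l dvd (K choose n)"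
  shows "cong0_Zring z (int p) l (xi z r s n)"
proof -
  define t where "t = var_z - fps_X"
  obtain s' r' k where *:
    "[int s' = s] (mod (int p)\<^sup>2)" "[int r' = r] (mod (int p)\<^sup>2)" "k > 0"
    "ring_ideal.eqv (kz_ideal (p ^ l) (Suc n) N) ((t ^ r') ^ k) 1"
    "ring_ideal.eqv (kz_ideal (p ^ l) (Suc n) N) (fps_const (fps_nth (t ^ r') 0) ^ k) 1"
    "\<And>g. ring_ideal.eqv (kz_ideal (p ^ l) (Suc n) N) (t ^ s' * strange_sum 1 (t ^ r') k) g \<Longrightarrow>
       of_nat (p ^ l) dvd fps_nth g n \<Longrightarrow> cong0_Zring z (int p) l (xi z r s n)"
    using xi_reduce[OF assms(1-3), of s r l n] unfolding t_def by blast
  interpret ring_ideal "kz_ideal (p ^ l) (Suc n) N" by (rule ring_ideal_kz_ideal)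
  obtain B e where B: "eqv (strange_sum 1 (t ^ r') k) (\<Sum>m\<le>B. fps_const (e m) * pent_coeff (t ^ r') m)"
    using strange_sum_expansion(1)[OF ring_ideal_kz_ideal *(4,5,3) kz_ideal_dvd(2)[OF dvd_refl]] by blast
  show ?thesis
  proof (rule *(6)[OF eqv_mult[OF eqv_refl B]])
    have "of_nat (p ^ l) dvd fps_nth (fps_const (e m) * (t ^ s' * pent_coeff (t ^ r') m)) n" for m
    proof (cases "chi m = 0")
      case False
      from dvd[OF False cong_exponent[OF *(1,2)]] show ?thesis
        unfolding t_def var_pent_coeff fps_mult_left_const_nth by (intro dvd_mult dvd_var_power_nth)
    qed (simp add: t_def var_pent_coeff)
    then show "of_nat (p ^ l) dvd fps_nth (t ^ s' * (\<Sum>m\<le>B. fps_const (e m) * pent_coeff (t ^ r') m)) n"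
      unfolding sum_distrib_left fps_sum_nth mult.left_commute[of "t ^ s'"] by (intro dvd_sum) auto
  qed
qed

text \<open>The terms with p dividing 2m + 1 are traded for p times a monomial times the sum at
  y^(p^2). Expanding the latter shifts exponents by multiples of p^2 only, and there p^(l-1)
  suffices next to the factor p.\<close>

lemma xi_cong_if_binomials_star:
  assumes "p > 0" "N \<ge> 1" "z ^ N = 1" and p: "p = 2 * a + 1" "a mod 3 \<noteq> 1" and "l \<ge> 1"
    and dvd: "\<And>K m. chi m \<noteq> 0 \<Longrightarrow> \<not> p dvd 2 * m + 1 \<Longrightarrow>
      [int K = s + r * int (m * (m + 1) div 6)] (mod (int p)\<^sup>2) \<Longrightarrow> p ^ l dvd (K choose n)"
    and dvd': "\<And>K. [int K = s + r * int (a * (a + 1) div 6)] (mod (int p)\<^sup>2) \<Longrightarrow> p ^ (l - 1) dvd (K choose n)"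
  shows "cong0_Zring z (int p) l (xi z r s n)"
proof -
  define t where "t = var_z - fps_X"
  obtain s' r' k where *:
    "[int s' = s] (mod (int p)\<^sup>2)" "[int r' = r] (mod (int p)\<^sup>2)" "k > 0"
    "ring_ideal.eqv (kz_ideal (p ^ l) (Suc n) N) ((t ^ r') ^ k) 1"
    "ring_ideal.eqv (kz_ideal (p ^ l) (Suc n) N) (fps_const (fps_nth (t ^ r') 0) ^ k) 1"
    "\<And>g. ring_ideal.eqv (kz_ideal (p ^ l) (Suc n) N) (t ^ s' * strange_sum 1 (t ^ r') k) g \<Longrightarrow>
       of_nat (p ^ l) dvd fps_nth g n \<Longrightarrow> cong0_Zring z (int p) l (xi z r s n)"
    using xi_reduce[OF assms(1-3), of s r l n] unfolding t_def by blast
  interpret ring_ideal "kz_ideal (p ^ l) (Suc n) N" by (rule ring_ideal_kz_ideal)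
  define y where "y = t ^ r'"
  have X: "fps_X ^ Suc n \<in> kz_ideal (p ^ l) (Suc n) N" by (rule kz_ideal_dvd(2)) simp
  have y2: "eqv ((y ^ p\<^sup>2) ^ k) 1" "eqv (fps_const (fps_nth (y ^ p\<^sup>2) 0) ^ k) 1"
    using eqv_power[OF *(4), of "p\<^sup>2"] eqv_power[OF *(5), of "p\<^sup>2"]
    by (simp_all add: y_def fps_power_zeroth fps_const_power mult_ac flip: power_mult)
  define f where "f B e = (\<Sum>m\<le>B. fps_const (e m) * (if p dvd 2 * m + 1 then 0 else pent_coeff y m))"
    for B :: nat and e
  define g where "g B e = (\<Sum>m\<le>B. fps_const (e m) * pent_coeff (y ^ p\<^sup>2) m)" for B :: nat and e
  obtain B e where B: "eqv (strange_sum 1 y k - of_nat p * pent_coeff y a * strange_sum 1 (y ^ p\<^sup>2) k) (f B e)"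
    using strange_sum_expansion(2)[OF ring_ideal_kz_ideal *(4,5,3) X p] unfolding f_def y_def by blast
  obtain B' e' where B': "eqv (strange_sum 1 (y ^ p\<^sup>2) k) (g B' e')"
    using strange_sum_expansion(1)[OF ring_ideal_kz_ideal y2 *(3) X] unfolding g_def by blast
  have "eqv (strange_sum 1 y k) (f B e + of_nat p * pent_coeff y a * g B' e')"
    using eqv_add[OF B eqv_mult[OF eqv_refl[of "of_nat p * pent_coeff y a"] B']] by simp
  from eqv_mult[OF eqv_refl[of "t ^ s'"] this]
  have sum: "eqv (t ^ s' * strange_sum 1 (t ^ r') k) (t ^ s' * f B e + t ^ s' * (of_nat p * pent_coeff y a * g B' e'))"
    by (simp add: y_def distrib_left)
  show ?thesis
  proof (rule *(6)[OF sum], unfold fps_add_nth, rule dvd_add)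
    have "of_nat (p ^ l) dvd fps_nth (fps_const (e m) * (t ^ s' * (if p dvd 2 * m + 1 then 0 else pent_coeff y m))) n" for m
    proof (cases "chi m = 0 \<or> p dvd 2 * m + 1")
      case False
      then have "p ^ l dvd ((s' + r' * (m * (m + 1) div 6)) choose n)"
        using dvd[OF _ _ cong_exponent[OF *(1,2)]] by blast
      then show ?thesis
        using False unfolding y_def t_def
        by (simp only: if_False de_Morgan_disj var_pent_coeff fps_mult_left_const_nth) (intro dvd_mult dvd_var_power_nth)
    qed (auto simp: t_def y_def var_pent_coeff)
    then show "of_nat (p ^ l) dvd fps_nth (t ^ s' * f B e) n"
      unfolding f_def sum_distrib_left fps_sum_nth mult.left_commute[of "t ^ s'"] by (intro dvd_sum) auto
  next
    have pl: "p ^ l = p * p ^ (l - 1)" using \<open>l \<ge> 1\<close> by (cases l) auto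
    have "of_nat (p ^ l) dvd fps_nth (t ^ s' * (of_nat p * pent_coeff y a * (fps_const (e' m) * pent_coeff (y ^ p\<^sup>2) m))) n" for m
    proof -
      \<comment> \<open>The exponent of one dilated term: its last summand is 0 modulo p^2, so
        \<open>dvd'\<close> applies.\<close>
      define K where "K = s' + r' * (a * (a + 1) div 6) + r' * p\<^sup>2 * (m * (m + 1) div 6)"
      have "t ^ s' * (of_nat p * pent_coeff y a * (fps_const (e' m) * pent_coeff (y ^ p\<^sup>2) m))
         = fps_const (of_nat p * e' m) * ((t ^ s' * pent_coeff (t ^ r') a) * pent_coeff (t ^ (r' * p\<^sup>2)) m)"
        by (simp add: y_def fps_of_nat mult_ac power_mult flip: fps_const_mult)
      also have "\<dots> = fps_const (of_nat p * e' m * of_int (chi a) * of_int (chi m)) * t ^ K"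
        unfolding t_def var_pent_coeff mult.assoc K_def
        by (simp add: var_pent_coeff[unfolded mult.assoc] mult_ac flip: fps_const_mult)
      finally have e: "t ^ s' * (of_nat p * pent_coeff y a * (fps_const (e' m) * pent_coeff (y ^ p\<^sup>2) m))
         = fps_const (of_nat p * e' m * of_int (chi a) * of_int (chi m)) * t ^ K" .
      have "[int K = int (s' + r' * (a * (a + 1) div 6))] (mod (int p)\<^sup>2)"
        by (simp add: K_def cong_iff_dvd_diff)
      also have "[int (s' + r' * (a * (a + 1) div 6)) = s + r * int (a * (a + 1) div 6)] (mod (int p)\<^sup>2)"
        by (rule cong_exponent[OF *(1,2)])
      finally have "of_nat (p ^ (l - 1)) dvd fps_nth (t ^ K) n"
        unfolding t_def by (intro dvd_var_power_nth dvd')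
      then have "of_nat p * of_nat (p ^ (l - 1)) dvd of_nat p * fps_nth (t ^ K) n"
        by (rule mult_dvd_mono[OF dvd_refl])
      then have "of_nat p * of_nat (p ^ (l - 1)) dvd (e' m * of_int (chi a) * of_int (chi m)) * (of_nat p * fps_nth (t ^ K) n)"
        by (rule dvd_mult)
      then show ?thesis
        unfolding e fps_mult_left_const_nth pl of_nat_mult by (simp only: mult_ac)
    qed
    then show "of_nat (p ^ l) dvd fps_nth (t ^ s' * (of_nat p * pent_coeff y a * g B' e')) n"
      unfolding g_def sum_distrib_left fps_sum_nth by (intro dvd_sum) auto
  qed
qed

section \<open>Residues of the exponents and the final divisibility\<close>

lemma finite_Sset: "finite (Sset p r s)"
  by (rule finite_subset[of _ "{0..p - 1}"]) (auto simp: Sset_def)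

lemma residue_in_Sset:
  assumes "p > 0" "chi m \<noteq> 0" "[K = s + r * int (m * (m + 1) div 6)] (mod p\<^sup>2)"
  shows "K mod p \<in> Sset p r s"
proof -
  obtain k :: int where k: "int (m * (m + 1) div 6) = k * (3 * k - 1) div 2"
    using pent_exponent[OF assms(2)] by blast
  have "[K = s + r * (k * (3 * k - 1) div 2)] (mod p)"
    using assms(3) unfolding k by (rule cong_dvd_modulus) (simp add: power2_eq_square)
  then have "[K mod p - s = s + r * (k * (3 * k - 1) div 2) - s] (mod p)"
    by (intro cong_diff cong_refl) (simp add: cong_def)
  then have "[K mod p - s = r * (k * (3 * k - 1) div 2)] (mod p)" by simp
  then show ?thesis using assms(1) by (auto simp: Sset_def)
qed

text \<open>With E = m(m + 1)/6 one has 24 E + 1 = (2m + 1)^2, so 24(K - s) + r is congruent to r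
  (2m + 1)^2, which is prime to p.\<close>

lemma residue_in_Sstar:
  assumes "prime p" "\<not> p dvd r" "chi m \<noteq> 0" "\<not> p dvd 2 * int m + 1"
    and "[K = s + r * int (m * (m + 1) div 6)] (mod p\<^sup>2)"
  shows "K mod p \<in> Sstar p r s"
proof -
  have p0: "p > 0" using \<open>prime p\<close> by (rule prime_gt_0_int)
  obtain E where E: "m * (m + 1) = 6 * E" using chi_neq_0[OF assms(3)] by (auto elim: dvdE)
  then have E6: "m * (m + 1) div 6 = E" by simp
  have sq: "24 * int E + 1 = (2 * int m + 1) * (2 * int m + 1)"
    using arg_cong[OF E, of int] by (simp add: algebra_simps)
  have "\<not> [24 * (K mod p - s) = - r] (mod p)"
  proof
    assume *: "[24 * (K mod p - s) = - r] (mod p)"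
    have "[K = s + r * int E] (mod p)"
      using assms(5) unfolding E6 by (rule cong_dvd_modulus) (simp add: power2_eq_square)
    then have "[24 * (K mod p - s) = 24 * (s + r * int E - s)] (mod p)"
      by (intro cong_mult cong_diff cong_refl) (simp add: cong_def)
    with * have "[24 * (s + r * int E - s) = - r] (mod p)"
      using cong_sym cong_trans by blast
    then have "p dvd r * (24 * int E + 1)"
      by (simp add: cong_iff_dvd_diff algebra_simps)
    then show False
      using assms(1,2,4) unfolding sq by (simp add: prime_dvd_mult_iff)
  qed
  then show ?thesis using residue_in_Sset[OF p0 assms(3,5)] by (simp add: Sstar_def)
qed

text \<open>The index m = 0 puts s mod p into the set, so \<open>Max\<close> is taken over a
  nonempty set. The bound later yields j < p.\<close>

lemma Max_Sstar_nonneg: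
  assumes "prime p" "\<not> p dvd r"
  shows "Max (Sstar p r s) \<ge> 0"
proof -
  have "s mod p \<in> Sstar p r s"
    using assms by (intro residue_in_Sstar[of p r 0]) (auto simp: chi_def)
  moreover have "finite (Sstar p r s)"
    using finite_Sset by (rule rev_finite_subset) (auto simp: Sstar_def)
  ultimately have "s mod p \<le> Max (Sstar p r s)" by (intro Max_ge)
  moreover have "s mod p \<ge> 0" using prime_gt_0_int[OF assms(1)] by simp
  ultimately show ?thesis by linarith
qed

theorem theorem3p1:
  fixes p r s :: int and N :: nat and z :: complex
  assumes "prime p" and "p \<ge> 5" and "N \<ge> 1" and "z ^ N = 1" and "\<not> p dvd r"
  shows "(\<forall>lam m :: nat. \<forall>j :: int.
            m \<ge> 1 \<longrightarrow> 1 \<le> j \<longrightarrow> j \<le> p - 1 - Max (Sset p r s) \<longrightarrow>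
            0 \<le> p ^ lam * int m - j \<longrightarrow>
            cong0_Zring z p lam (xi z r s (nat (p ^ lam * int m - j))))
       \<and> ((int N dvd r * p \<and> digit1 (of_int s - of_int r / 24) p < p - 1) \<longrightarrow>
          (\<forall>lam m :: nat. \<forall>j :: int.
            m \<ge> 1 \<longrightarrow> 1 \<le> j \<longrightarrow> j \<le> p - 1 - Max (Sstar p r s) \<longrightarrow>
            0 \<le> p ^ lam * int m - j \<longrightarrow>
            cong0_Zring z p lam (xi z r s (nat (p ^ lam * int m - j)))))"
proof -
  define P where "P = nat p"
  have P: "int P = p" and "prime P" "P > 0"
    using assms(1,2) by (auto simp: P_def)
  have index: "nat (p ^ l * int m - j) + nat j = P ^ l * m"
    if "1 \<le> j" "0 \<le> p ^ l * int m - j" for l m j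
  proof -
    have "int (nat (p ^ l * int m - j) + nat j) = int (P ^ l * m)" using that P by simp
    then show ?thesis by (simp only: of_nat_eq_iff)
  qed
  have binom: "P ^ l dvd (K choose nat (p ^ l * int m - j))"
    if j: "1 \<le> j" "j \<le> p - 1 - Max S" "0 \<le> p ^ l * int m - j"
      and S: "finite S" "int K mod p \<in> S" for S K l m j
  proof (rule prime_power_dvd_binomial[OF \<open>prime P\<close> index[OF j(1,3)]])
    have "int K mod p \<le> Max S" using S by (rule Max_ge)
    then have "int (K mod P) + j < int P" using j(2) P by (simp add: zmod_int)
    then show "K mod P + nat j < P" using j(1) by linarith
  qed (use j in auto)
  have part1: "cong0_Zring z p l (xi z r s (nat (p ^ l * int m - j)))"
    if "1 \<le> j" "j \<le> p - 1 - Max (Sset p r s)" "0 \<le> p ^ l * int m - j" for l m j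
    unfolding P [symmetric]
  proof (rule xi_cong_if_binomials[OF \<open>P > 0\<close> assms(3,4)], unfold P)
    fix K k assume "chi k \<noteq> 0" "[int K = s + r * int (k * (k + 1) div 6)] (mod p\<^sup>2)"
    then show "P ^ l dvd (K choose nat (p ^ l * int m - j))"
      using assms(2) by (intro binom[OF that finite_Sset] residue_in_Sset) auto
  qed
  have part2: "cong0_Zring z p l (xi z r s (nat (p ^ l * int m - j)))"
    if d: "digit1 (of_int s - of_int r / 24) p < p - 1"
      and j: "1 \<le> j" "j \<le> p - 1 - Max (Sstar p r s)" "0 \<le> p ^ l * int m - j" for l m j
  \<comment> \<open>The criterion for \<open>Sstar\<close> splits off one factor p and so needs l >=
    1; for l = 0 the binomial divisibility is by 1.\<close>
  proof (cases "l = 0")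
    case True
    show ?thesis
      unfolding P [symmetric] by (rule xi_cong_if_binomials[OF \<open>P > 0\<close> assms(3,4)]) (simp add: True)
  next
    case False
    define a where "a = P div 2"
    have "odd P" using \<open>prime P\<close> assms(2) P prime_odd_nat[of P] by linarith
    then have a: "P = 2 * a + 1" by (simp add: a_def)
    have "a mod 3 \<noteq> 1"
    proof
      assume "a mod 3 = 1"
      then have "3 dvd P" unfolding a by presburger
      then have "P = 3" using \<open>prime P\<close> by (auto simp: prime_nat_iff)
      then show False using P assms(2) by simp
    qed
    note a = a this
    have p24: "\<not> p dvd 24"
    proof
      assume "p dvd 24"
      then have "p dvd 2 * (2 * (2 * 3))" by simp
      then have "p dvd 2 \<or> p dvd 3" using assms(1) unfolding prime_dvd_mult_iff[OF assms(1)] by blast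
      then show False using assms(2) by (auto dest: zdvd_imp_le)
    qed
    have "finite (Sstar p r s)"
      using finite_Sset by (rule rev_finite_subset) (auto simp: Sstar_def)
    note fin = this
    show ?thesis
      unfolding P [symmetric]
    proof (rule xi_cong_if_binomials_star[OF \<open>P > 0\<close> assms(3,4) a], unfold P)
      show "1 \<le> l" using False by simp
    next
      fix K k assume "chi k \<noteq> 0" "\<not> P dvd 2 * k + 1"
        "[int K = s + r * int (k * (k + 1) div 6)] (mod p\<^sup>2)"
      moreover from this(2) have "\<not> int P dvd int (2 * k + 1)" unfolding int_dvd_int_iff .
      then have "\<not> p dvd 2 * int k + 1" unfolding P by (simp add: add.commute)
      ultimately show "P ^ l dvd (K choose nat (p ^ l * int m - j))"
        by (intro binom[OF j fin] residue_in_Sstar assms)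
    next
      \<comment> \<open>Here K is congruent to s - r/24 modulo p^2, because 24 times a(a + 1)/6 is
        p^2 - 1. Its digit at p is therefore the given \<open>digit1\<close>, at most p - 2.\<close>
      fix K assume K: "[int K = s + r * int (a * (a + 1) div 6)] (mod p\<^sup>2)"
      have "chi a \<noteq> 0" using a(2) by (auto simp: chi_def; presburger)
      then obtain E where E: "a * (a + 1) = 6 * E" using chi_neq_0[of a] by (auto elim: dvdE)
      then have E6: "a * (a + 1) div 6 = E" by simp
      have "24 * int E + 1 = p\<^sup>2"
        using arg_cong[OF E, of int] unfolding P[symmetric] a(1) by (simp add: algebra_simps power2_eq_square)
      then have E24: "24 * int E = p\<^sup>2 - 1" by simp
      have "24 * (s + r * int E) = 24 * s + r * (24 * int E)" by (simp add: algebra_simps)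
      also have "\<dots> = 24 * s - r + p\<^sup>2 * r" unfolding E24 by (simp add: algebra_simps)
      finally have e: "24 * (s + r * int E) = 24 * s - r + p\<^sup>2 * r" .
      have "[24 * int K = 24 * (s + r * int E)] (mod p\<^sup>2)"
        using K unfolding E6 by (intro cong_mult cong_refl)
      then have "[24 * int K = 24 * s - r] (mod p\<^sup>2)"
        unfolding e by (simp add: cong_def)
      from digit1_eq[OF assms(1) p24 this]
      have "(int K div p) mod p < p - 1"
        using d by (simp add: diff_divide_distrib)
      moreover have "int K mod p\<^sup>2 = p * ((int K div p) mod p) + int K mod p"
        unfolding power2_eq_square using assms(2) by (intro zmod_zmult2_eq) simp
      moreover have "int K mod p < p" using assms(2) by simp
      moreover have jp: "j < p" using j(2) Max_Sstar_nonneg[OF assms(1,5), of s] by linarith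
      moreover have "p * ((int K div p) mod p) \<le> p * (p - 2)"
        using calculation(1) assms(2) by (intro mult_left_mono) auto
      \<comment> \<open>The left side is at most p(p - 2) + (p - 1) + (p - 1) = p^2 - 2.\<close>
      ultimately have "int K mod p\<^sup>2 + j < p\<^sup>2"
        by (simp add: power2_eq_square algebra_simps)
      then have "int (K mod P\<^sup>2) + j < int (P\<^sup>2)" using P by (simp add: zmod_int)
      then have "K mod P\<^sup>2 + nat j < P\<^sup>2" using j(1) by linarith
      then show "P ^ (l - 1) dvd (K choose nat (p ^ l * int m - j))"
        using j(1) jp P
        by (intro prime_power_dvd_binomial_pred[OF \<open>prime P\<close> index[OF j(1,3)]]) auto
    qed
  qed
  show ?thesis using part1 part2 by blast
qed

end
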